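(* Let $(M,F)$ be a Finsler surface with nonflat geodesic spray $S$, and let $(H,S,V,\mathcal{C})$ be its Berwald frame. Let $\mathcal{F}:=H(\mathcal{I})+V(\mathcal{J})$. The only nonvanishing components of the curvature of the Berwald connection on the Berwald frame (up to antisymmetry in the first two arguments, and up to those obtained by applying $J$ to the result and to the last argument) are: (1) the $hh$-curvature components $R(S,H)S=-\rho\,H$ and $R(S,H)H=\{S(\mathcal{J})+\rho\,\mathcal{I}\}\,H+\rho\,S$; (2) the $hv$-curvature component $B(V,H)H=\mathcal{F}\,H-2\,\mathcal{J}\,S$. Consequently, $R(S,H)\mathcal{C}=-\rho\,V$, $R(S,H)V=\{S(\mathcal{J})+\rho\,\mathcal{I}\}\,V+\rho\,\mathcal{C}$, and $B(V,H)V=\mathcal{F}\,V-2\,\mathcal{J}\,\mathcal{C}$.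
   Context: $M$ is a $2$-dimensional smooth manifold, $\mathcal{T}M$ its tangent bundle with the zero section removed, with induced coordinates $(x^i,y^i)$; $J=\frac{\partial}{\partial y^i}\otimes dx^i$ is the almost-tangent structure and $\mathcal{C}=y^i\frac{\partial}{\partial y^i}$ the Liouville vector field. $F:TM\to\mathbb{R}$ is a Finsler function: smooth and positive on $\mathcal{T}M$, zero exactly on the zero section, positively $1$-homogeneous in $y$, with $g_{ij}=\frac12\frac{\partial^2F^2}{\partial y^i\partial y^j}$ of maximal rank on $\mathcal{T}M$. $S=y^i\frac{\partial}{\partial x^i}-2G^i\frac{\partial}{\partial y^i}$ is its geodesic spray, $h=\frac12(Id+[J,S])$ and $v=\frac12(Id-[J,S])$ (Frölicher–Nijenhuis bracket) are the horizontal and vertical projectors. With $G^i_j=\partial G^i/\partial y^j$, the Jacobi endomorphism is $\Phi=\big(2\frac{\partial G^i}{\partial x^j}-S(G^i_j)-G^i_kG^k_j\big)\frac{\partial}{\partial y^i}\otimes dx^j$; in dimension $2$ one has $\Phi=K(F^2J-F\,d_JF\otimes\mathcal{C})$, where $K\in C^\infty(\mathcal{T}M)$ is the flag curvature; the Ricci scalar is $\rho=KF^2$. $S$ is nonflat: $K$ vanishes nowhere on $\mathcal{T}M$. Berwald frame: $H$ is a horizontal vector field on $\mathcal{T}M$ with $[\mathcal{C},H]=H$, $d_JF(H)=0$, $V:=JH$, normalized so that $[S,H]=\rho V$, $[V,S]=H$, $[H,V]=S+\mathcal{I}H+\mathcal{J}V$ with $\mathcal{J}=S(\mathcal{I})$.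 Here $\mathcal{I}$ is the main (Cartan) scalar and $\mathcal{J}$ the Landsberg scalar; $\mathcal{C}(\mathcal{I})=0$ and $\mathcal{C}(\mathcal{J})=\mathcal{J}$; also $[\mathcal{C},S]=S$, $[\mathcal{C},V]=0$. $(H,S,V,\mathcal{C})$ is a global frame on $\mathcal{T}M$. Berwald connection: $D_XY=v[hX,vY]+h[vX,hY]+J[vX,\theta Y]+\theta[hX,JY]$ with $\theta=h\circ[S,h]$. Its curvature is $D_XD_YZ-D_YD_XZ-D_{[X,Y]}Z$; it is denoted $R(X,Y)Z$ when $X,Y$ are both horizontal ($hh$-curvature) and $B(X,Y)Z$ when $X$ is vertical and $Y$ is horizontal ($hv$-curvature). *)

theory Defs
  imports "HOL-Analysis.Analysis" "HOL-Library.Function_Algebras"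
begin

section \<open>Smooth manifolds, tangent vectors and vector fields\<close>

primrec Ck_on :: "nat \<Rightarrow> 'a::real_normed_vector set \<Rightarrow> ('a \<Rightarrow> 'b::real_normed_vector) \<Rightarrow> bool" where
  "Ck_on 0 U f \<longleftrightarrow> continuous_on U f"
| "Ck_on (Suc k) U f \<longleftrightarrow> (\<forall>x\<in>U. f differentiable (at x)) \<and>
     (\<forall>v. Ck_on k U (\<lambda>x. frechet_derivative f (at x) v))"

text \<open>Only used for open \<open>U\<close>.\<close>

definition smooth_on :: "'a::real_normed_vector set \<Rightarrow> ('a \<Rightarrow> 'b::real_normed_vector) \<Rightarrow> bool" where
  "smooth_on U f \<longleftrightarrow> (\<forall>k. Ck_on k U f)"

text \<open>A chart is a domain together with a coordinate map, whose values off the domain are irrelevant.\<close>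

type_synonym ('p, 'e) chart = "'p set \<times> ('p \<Rightarrow> 'e)"

definition chart_inv :: "('p, 'e) chart \<Rightarrow> 'e \<Rightarrow> 'p" where
  "chart_inv c = the_inv_into (fst c) (snd c)"

definition transition :: "('p, 'e) chart \<Rightarrow> ('p, 'e) chart \<Rightarrow> 'e \<Rightarrow> 'e" where
  "transition c d = snd d \<circ> chart_inv c"

definition carrier_of :: "('p, 'e) chart set \<Rightarrow> 'p set" where
  "carrier_of A = (\<Union>c\<in>A. fst c)"

definition smooth_manifold :: "'p topology \<Rightarrow> ('p, 'e::euclidean_space) chart set \<Rightarrow> bool" where
  "smooth_manifold M A \<longleftrightarrow>
     Hausdorff_space M \<and> second_countable M \<and> carrier_of A = topspace M \<and>
     (\<forall>c\<in>A. openin M (fst c) \<and> open (snd c ` fst c) \<and>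
        homeomorphic_map (subtopology M (fst c)) (top_of_set (snd c ` fst c)) (snd c)) \<and>
     (\<forall>c\<in>A. \<forall>d\<in>A. smooth_on (snd c ` (fst c \<inter> fst d)) (transition c d))"

text \<open>A tangent vector at \<open>p\<close> is the family of its coordinate vectors in the charts around \<open>p\<close>,
  related by the derivatives of the coordinate changes; it is \<open>0\<close> by convention at all other
  charts, so that equality of tangent vectors is equality of functions.\<close>

type_synonym ('p, 'e) tvec = "('p, 'e) chart \<Rightarrow> 'e"

definition tangent_space :: "('p, 'e::euclidean_space) chart set \<Rightarrow> 'p \<Rightarrow> ('p, 'e) tvec set" where
  "tangent_space A p =
     {v. (\<forall>c\<in>A. \<forall>d\<in>A. p \<in> fst c \<inter> fst d \<longrightarrow>
            v d = frechet_derivative (transition c d) (at (snd c p)) (v c)) \<and>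
         (\<forall>c. \<not> (c \<in> A \<and> p \<in> fst c) \<longrightarrow> v c = 0)}"

type_synonym ('p, 'e) vfield = "'p \<Rightarrow> ('p, 'e) tvec"

definition vf_rep :: "('p, 'e) chart \<Rightarrow> ('p, 'e) vfield \<Rightarrow> 'e \<Rightarrow> 'e" where
  "vf_rep c X = (\<lambda>z. X (chart_inv c z) c)"

definition smooth_function :: "('p, 'e::euclidean_space) chart set \<Rightarrow> ('p \<Rightarrow> real) \<Rightarrow> bool" where
  "smooth_function A f \<longleftrightarrow> (\<forall>c\<in>A. smooth_on (snd c ` fst c) (f \<circ> chart_inv c))"

definition vector_field :: "('p, 'e::euclidean_space) chart set \<Rightarrow> ('p, 'e) vfield \<Rightarrow> bool" where
  "vector_field A X \<longleftrightarrow> (\<forall>p\<in>carrier_of A. X p \<in> tangent_space A p) \<and>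
     (\<forall>c\<in>A. smooth_on (snd c ` fst c) (vf_rep c X))"

text \<open>Sums and differences of vector fields and of functions are the pointwise ones of
  \<open>Function_Algebras\<close>.\<close>

definition vf_scale :: "('p \<Rightarrow> real) \<Rightarrow> ('p, 'e::real_vector) vfield \<Rightarrow> ('p, 'e) vfield"
    (infixr "\<odot>" 75) where
  "f \<odot> X = (\<lambda>p c. f p *\<^sub>R X p c)"

text \<open>\<open>X(f)\<close>; for smooth \<open>f\<close> the value does not depend on the chart selected.\<close>

definition vf_apply ::
    "('p, 'e::euclidean_space) chart set \<Rightarrow> ('p, 'e) vfield \<Rightarrow> ('p \<Rightarrow> real) \<Rightarrow> 'p \<Rightarrow> real" where
  "vf_apply A X f p = (let c = (SOME c. c \<in> A \<and> p \<in> fst c)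
     in frechet_derivative (f \<circ> chart_inv c) (at (snd c p)) (X p c))"

definition lie_bracket ::
    "('p, 'e::euclidean_space) chart set \<Rightarrow> ('p, 'e) vfield \<Rightarrow> ('p, 'e) vfield \<Rightarrow> ('p, 'e) vfield" where
  "lie_bracket A X Y = (\<lambda>p c. if c \<in> A \<and> p \<in> fst c
     then frechet_derivative (vf_rep c Y) (at (snd c p)) (X p c)
        - frechet_derivative (vf_rep c X) (at (snd c p)) (Y p c)
     else 0)"

text \<open>Vector-valued one-forms are given as operators on vector fields. The Froelicher-Nijenhuis
  brackets with a vector field \<open>S\<close> are \<open>[L, S]X = [LX, S] - L[X, S]\<close> and
  \<open>[S, L]X = [S, LX] - L[S, X]\<close>.\<close>

definition fn_bracket_form_field where
  "fn_bracket_form_field A L S X = lie_bracket A (L X) S - L (lie_bracket A X S)"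

definition fn_bracket_field_form where
  "fn_bracket_field_form A S L X = lie_bracket A S (L X) - L (lie_bracket A S X)"

definition eq_on :: "'p set \<Rightarrow> ('p \<Rightarrow> 'b) \<Rightarrow> ('p \<Rightarrow> 'b) \<Rightarrow> bool" where
  "eq_on D f g \<longleftrightarrow> (\<forall>p\<in>D. f p = g p)"


section \<open>The slit tangent bundle of a surface\<close>

type_synonym 'm tpoint = "'m \<times> ('m, real^2) tvec"
type_synonym 'm satlas = "('m tpoint, (real^2) \<times> (real^2)) chart set"
type_synonym 'm svfield = "('m tpoint, (real^2) \<times> (real^2)) vfield"

definition tangent_bundle :: "('m, real^2) chart set \<Rightarrow> 'm tpoint set" where
  "tangent_bundle A = {(p, v). p \<in> carrier_of A \<and> v \<in> tangent_space A p}"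

definition slit_bundle :: "('m, real^2) chart set \<Rightarrow> 'm tpoint set" where
  "slit_bundle A = {(p, v). (p, v) \<in> tangent_bundle A \<and> v \<noteq> (\<lambda>_. 0)}"

text \<open>The induced coordinates \<open>(x, y)\<close>.\<close>

definition slit_chart ::
    "('m, real^2) chart set \<Rightarrow> ('m, real^2) chart \<Rightarrow> ('m tpoint, (real^2) \<times> (real^2)) chart" where
  "slit_chart A c = ({(p, v). (p, v) \<in> slit_bundle A \<and> p \<in> fst c}, \<lambda>(p, v). (snd c p, v c))"

definition slit_atlas :: "('m, real^2) chart set \<Rightarrow> 'm satlas" where
  "slit_atlas A = slit_chart A ` A"

definition almost_tangent :: "'m svfield \<Rightarrow> 'm svfield" where
  "almost_tangent X = (\<lambda>u k. (0, fst (X u k)))"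

definition liouville :: "('m, real^2) chart set \<Rightarrow> 'm svfield" where
  "liouville A = (\<lambda>u k. if k \<in> slit_atlas A \<and> u \<in> fst k then (0, snd (snd k u)) else 0)"

definition partial_x :: "2 \<Rightarrow> ((real^2) \<times> (real^2) \<Rightarrow> real) \<Rightarrow> (real^2) \<times> (real^2) \<Rightarrow> real" where
  "partial_x i f z = frechet_derivative f (at z) (axis i 1, 0)"

definition partial_y :: "2 \<Rightarrow> ((real^2) \<times> (real^2) \<Rightarrow> real) \<Rightarrow> (real^2) \<times> (real^2) \<Rightarrow> real" where
  "partial_y i f z = frechet_derivative f (at z) (0, axis i 1)"

text \<open>\<open>d\<^sub>J f (X) = (JX)(f)\<close>.\<close>

definition d_J :: "('m, real^2) chart set \<Rightarrow> ('m tpoint \<Rightarrow> real) \<Rightarrow> 'm svfield \<Rightarrow> 'm tpoint \<Rightarrow> real" where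
  "d_J A f X = vf_apply (slit_atlas A) (almost_tangent X) f"


section \<open>Finsler functions and their geodesic sprays\<close>

definition finsler_square_rep where
  "finsler_square_rep F k = (\<lambda>z. (F (chart_inv k z))\<^sup>2)"

definition finsler_metric ::
    "('m tpoint \<Rightarrow> real) \<Rightarrow> ('m tpoint, (real^2) \<times> (real^2)) chart \<Rightarrow> (real^2) \<times> (real^2) \<Rightarrow> real^2^2" where
  "finsler_metric F k z =
     (\<chi> i j. 1/2 * partial_y i (partial_y j (finsler_square_rep F k)) z)"

definition finsler_function :: "('m, real^2) chart set \<Rightarrow> ('m tpoint \<Rightarrow> real) \<Rightarrow> bool" where
  "finsler_function A F \<longleftrightarrow>
     smooth_function (slit_atlas A) F \<and>
     (\<forall>u\<in>slit_bundle A. F u > 0) \<and>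
     (\<forall>p\<in>carrier_of A. F (p, \<lambda>_. 0) = 0) \<and>
     (\<forall>p v t. (p, v) \<in> tangent_bundle A \<and> t > 0 \<longrightarrow> F (p, \<lambda>c. t *\<^sub>R v c) = t * F (p, v)) \<and>
     (\<forall>k\<in>slit_atlas A. \<forall>u\<in>fst k. rank (finsler_metric F k (snd k u)) = 2)"

text \<open>\<open>JS = \<C>\<close> and \<open>[\<C>, S] = S\<close>: in induced coordinates \<open>S = y\<^sup>i \<partial>/\<partial>x\<^sup>i - 2 G\<^sup>i \<partial>/\<partial>y\<^sup>i\<close>
  with \<open>G\<^sup>i\<close> positively 2-homogeneous in \<open>y\<close>.\<close>

definition spray :: "('m, real^2) chart set \<Rightarrow> 'm svfield \<Rightarrow> bool" where
  "spray A S \<longleftrightarrow> vector_field (slit_atlas A) S \<and>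
     eq_on (slit_bundle A) (almost_tangent S) (liouville A) \<and>
     eq_on (slit_bundle A) (lie_bracket (slit_atlas A) (liouville A) S) S"

text \<open>The Euler-Lagrange equations \<open>S(\<partial>F\<^sup>2/\<partial>y\<^sup>i) = \<partial>F\<^sup>2/\<partial>x\<^sup>i\<close>, i.e.\ \<open>i\<^sub>S d d\<^sub>J F\<^sup>2 = - d F\<^sup>2\<close>;
  by nondegeneracy of the metric they determine \<open>S\<close>.\<close>

definition geodesic_spray ::
    "('m, real^2) chart set \<Rightarrow> ('m tpoint \<Rightarrow> real) \<Rightarrow> 'm svfield \<Rightarrow> bool" where
  "geodesic_spray A F S \<longleftrightarrow> spray A S \<and>
     (\<forall>k\<in>slit_atlas A. \<forall>u\<in>fst k. \<forall>i.
        frechet_derivative (partial_y i (finsler_square_rep F k)) (at (snd k u)) (S u k)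
          = partial_x i (finsler_square_rep F k) (snd k u))"

definition horizontal_proj :: "('m, real^2) chart set \<Rightarrow> 'm svfield \<Rightarrow> 'm svfield \<Rightarrow> 'm svfield" where
  "horizontal_proj A S X =
     (\<lambda>_. 1/2) \<odot> (X + fn_bracket_form_field (slit_atlas A) almost_tangent S X)"

definition vertical_proj :: "('m, real^2) chart set \<Rightarrow> 'm svfield \<Rightarrow> 'm svfield \<Rightarrow> 'm svfield" where
  "vertical_proj A S X =
     (\<lambda>_. 1/2) \<odot> (X - fn_bracket_form_field (slit_atlas A) almost_tangent S X)"

definition horizontal :: "('m, real^2) chart set \<Rightarrow> 'm svfield \<Rightarrow> 'm svfield \<Rightarrow> bool" where
  "horizontal A S X \<longleftrightarrow> eq_on (slit_bundle A) (horizontal_proj A S X) X"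

definition spray_coeff ::
    "'m svfield \<Rightarrow> ('m tpoint, (real^2) \<times> (real^2)) chart \<Rightarrow> 2 \<Rightarrow> (real^2) \<times> (real^2) \<Rightarrow> real" where
  "spray_coeff S k i = (\<lambda>z. - (1/2) * snd (vf_rep k S z) $ i)"

definition connection_coeff where
  "connection_coeff S k i j = partial_y j (spray_coeff S k i)"

definition jacobi_coeff where
  "jacobi_coeff S k i j z =
     2 * partial_x j (spray_coeff S k i) z
     - frechet_derivative (connection_coeff S k i j) (at z) (vf_rep k S z)
     - (\<Sum>l\<in>UNIV. connection_coeff S k i l z * connection_coeff S k l j z)"

definition jacobi_endomorphism :: "'m svfield \<Rightarrow> 'm svfield \<Rightarrow> 'm svfield" where
  "jacobi_endomorphism S X =
     (\<lambda>u k. (0, \<chi> i. \<Sum>j\<in>UNIV. jacobi_coeff S k i j (snd k u) * fst (X u k) $ j))"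

text \<open>\<open>\<Phi> = K (F\<^sup>2 J - F d\<^sub>J F \<otimes> \<C>)\<close>.\<close>

definition flag_curvature ::
    "('m, real^2) chart set \<Rightarrow> ('m tpoint \<Rightarrow> real) \<Rightarrow> 'm svfield \<Rightarrow> ('m tpoint \<Rightarrow> real) \<Rightarrow> bool" where
  "flag_curvature A F S K \<longleftrightarrow> smooth_function (slit_atlas A) K \<and>
     (\<forall>X. vector_field (slit_atlas A) X \<longrightarrow>
        eq_on (slit_bundle A) (jacobi_endomorphism S X)
          (K \<odot> ((F * F) \<odot> almost_tangent X - (F * d_J A F X) \<odot> liouville A)))"


section \<open>Berwald frame and Berwald connection\<close>

text \<open>\<open>\<I>\<close> and \<open>\<J>\<close> are the main scalar and the Landsberg scalar. That \<open>(H, S, V, \<C>)\<close> is a frame and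
  that \<open>[\<C>, V] = 0\<close>, \<open>\<C>(\<I>) = 0\<close>, \<open>\<C>(\<J>) = \<J>\<close> follows.\<close>

definition berwald_frame ::
    "('m, real^2) chart set \<Rightarrow> ('m tpoint \<Rightarrow> real) \<Rightarrow> 'm svfield \<Rightarrow> ('m tpoint \<Rightarrow> real) \<Rightarrow>
     'm svfield \<Rightarrow> 'm svfield \<Rightarrow> ('m tpoint \<Rightarrow> real) \<Rightarrow> ('m tpoint \<Rightarrow> real) \<Rightarrow> bool" where
  "berwald_frame A F S \<rho> H V \<I> \<J> \<longleftrightarrow>
     (let T = slit_bundle A; lie = lie_bracket (slit_atlas A) in
      vector_field (slit_atlas A) H \<and>
      horizontal A S H \<and>
      eq_on T (lie (liouville A) H) H \<and>
      eq_on T (d_J A F H) 0 \<and>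
      eq_on T V (almost_tangent H) \<and>
      smooth_function (slit_atlas A) \<I> \<and>
      eq_on T \<J> (vf_apply (slit_atlas A) S \<I>) \<and>
      eq_on T (lie S H) (\<rho> \<odot> V) \<and>
      eq_on T (lie V S) H \<and>
      eq_on T (lie H V) (S + \<I> \<odot> H + \<J> \<odot> V))"

definition theta :: "('m, real^2) chart set \<Rightarrow> 'm svfield \<Rightarrow> 'm svfield \<Rightarrow> 'm svfield" where
  "theta A S X = horizontal_proj A S
     (fn_bracket_field_form (slit_atlas A) S (horizontal_proj A S) X)"

definition berwald_connection ::
    "('m, real^2) chart set \<Rightarrow> 'm svfield \<Rightarrow> 'm svfield \<Rightarrow> 'm svfield \<Rightarrow> 'm svfield" where
  "berwald_connection A S X Y =
     (let h = horizontal_proj A S; v = vertical_proj A S; \<theta> = theta A S;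
          J = almost_tangent; lie = lie_bracket (slit_atlas A) in
      v (lie (h X) (v Y)) + h (lie (v X) (h Y)) + J (lie (v X) (\<theta> Y)) + \<theta> (lie (h X) (J Y)))"

definition berwald_curvature ::
    "('m, real^2) chart set \<Rightarrow> 'm svfield \<Rightarrow> 'm svfield \<Rightarrow> 'm svfield \<Rightarrow> 'm svfield \<Rightarrow> 'm svfield" where
  "berwald_curvature A S X Y Z =
     (let D = berwald_connection A S in
      D X (D Y Z) - D Y (D X Z) - D (lie_bracket (slit_atlas A) X Y) Z)"

end

theory Submission
  imports Defs
begin

text \<open>
  The Berwald connection \<open>D\<close> is built from the spray alone, and its curvature on the frame can be
  computed from the commutation relations of the frame once three properties are known: \<open>D\<close> is
  function linear in the first argument, a derivation in the second, and commutes with the almost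
  tangent structure \<open>J\<close>. The proof of these properties is a coordinate computation. In induced coordinates
  \<open>S = (y, s)\<close>; let \<open>N a\<close> be half the derivative of \<open>s\<close> in the vertical direction \<open>(0, a)\<close>. Then the
  projectors and \<open>\<theta>\<close> act pointwise, \<open>h (a, b) = (a, N a)\<close>, \<open>v (a, b) = (0, b - N a)\<close> and
  \<open>\<theta> (a, b) = (c, N c)\<close> with \<open>c = b - N a\<close> (\<open>horizontal_proj_at\<close>, \<open>vertical_proj_at\<close>, \<open>theta_at\<close>).
  Inserted in the definition of \<open>D X Y\<close>, all derivatives of \<open>X\<close> cancel, and \<open>D X Y\<close> is given by one
  first order operator, \<open>covariant\<close>, applied to the \<open>x\<close>-components of \<open>Y\<close> and of \<open>\<theta> Y\<close>
  (\<open>connection_at\<close>). The three properties are then immediate.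

  For horizontal \<open>Z\<close> the definition collapses: \<open>D X Z\<close> is \<open>\<theta> [X, J Z]\<close> for horizontal \<open>X\<close> and \<open>h [X, Z]\<close> for
  vertical \<open>X\<close>. The brackets of the frame therefore give \<open>D\<close> on \<open>H\<close> and \<open>S\<close> (\<open>connection_values\<close>), and
  the last two frame fields \<open>V = J H\<close> and \<open>\<C> = J S\<close> follow by applying \<open>J\<close>. Expanding the curvature with the
  derivation rule gives the stated components; the remaining ones are multiples of
  \<open>S(\<I>) - \<J>\<close>, \<open>\<C>(\<I>)\<close> and \<open>\<C>(\<J>) - \<J>\<close>, or zero. The first of these vanishes by assumption, the other two by
  the Jacobi identity for \<open>\<C>\<close>, \<open>H\<close>, \<open>V\<close> (\<open>homogeneity\<close>), in which coefficients may be compared because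
  \<open>H\<close> and \<open>V\<close> are independent: if the \<open>x\<close>-components of \<open>H\<close> vanished at a point, then \<open>H\<close> and \<open>V\<close>, hence also
  \<open>[H, V] = S + \<I> H + \<J> V\<close>, would vanish there, but \<open>S\<close> has no zeros.

  All identities between fields are verified chart by chart. Derivatives of functions along fields
  are defined by a chosen chart, so the chain rule for the coordinate changes of the slit tangent
  bundle is needed to know that any chart may be used (\<open>slit_transition\<close>, \<open>vf_apply_chart\<close>).
\<close>

section \<open>Calculus of smooth maps\<close>

lemma has_derivative_frechet:
  "f differentiable (at x) \<Longrightarrow> (f has_derivative frechet_derivative f (at x)) (at x)"
  by (simp add: frechet_derivative_works)

lemma frechet_eq: "(f has_derivative f') (at x) \<Longrightarrow> frechet_derivative f (at x) v = f' v"
  by (metis frechet_derivative_at)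

lemma Ck_on_cong:
  fixes f g :: "'a::real_normed_vector \<Rightarrow> 'b::real_normed_vector"
  assumes "open U" "\<And>x. x \<in> U \<Longrightarrow> f x = g x" "Ck_on k U f"
  shows "Ck_on k U g"
  using assms(2,3)
proof (induction k arbitrary: f g)
  case 0
  then show ?case by (simp cong: continuous_on_cong)
next
  case (Suc k)
  have fd: "f differentiable (at x)" if "x \<in> U" for x
    using Suc.prems that by simp
  have eq: "frechet_derivative f (at x) = frechet_derivative g (at x)" if "x \<in> U" for x
    by (rule frechet_derivative_transform_within_open[OF fd[OF that] assms(1) that Suc.prems(1)])
  have gd: "g differentiable (at x)" if "x \<in> U" for x
    using fd[OF that] has_derivative_transform_within_open[of f _ x UNIV U g] assms(1) that Suc.prems(1)
    unfolding differentiable_def by blast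
  show ?case
    using gd Suc.IH[of "\<lambda>x. frechet_derivative f (at x) v" "\<lambda>x. frechet_derivative g (at x) v" for v]
      eq Suc.prems(2) by auto
qed

lemma Ck_on_SucD:
  fixes f :: "'a::real_normed_vector \<Rightarrow> 'b::real_normed_vector"
  shows "Ck_on (Suc k) U f \<Longrightarrow> Ck_on k U f"
proof (induction k arbitrary: f)
  case 0
  then show ?case
    by (auto intro!: differentiable_imp_continuous_on differentiable_at_imp_differentiable_on)
next
  case (Suc k)
  then show ?case by simp
qed

lemma Ck_on_SucI:
  fixes f :: "'a::real_normed_vector \<Rightarrow> 'b::real_normed_vector"
  assumes "open U" "\<And>x. x \<in> U \<Longrightarrow> (f has_derivative f' x) (at x)"
    and "\<And>v. Ck_on k U (\<lambda>x. f' x v)"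
  shows "Ck_on (Suc k) U f"
proof -
  have "Ck_on k U (\<lambda>x. frechet_derivative f (at x) v)" for v
    by (rule Ck_on_cong[OF assms(1) _ assms(3)]) (simp add: frechet_eq[OF assms(2)])
  then show ?thesis using assms(2) by (auto simp: differentiable_def)
qed

lemma Ck_on_const: "Ck_on k U (\<lambda>_. c)"
  by (induction k arbitrary: c) auto

lemma Ck_on_add:
  fixes f g :: "'a::real_normed_vector \<Rightarrow> 'b::real_normed_vector"
  assumes "open U"
  shows "Ck_on k U f \<Longrightarrow> Ck_on k U g \<Longrightarrow> Ck_on k U (\<lambda>x. f x + g x)"
proof (induction k arbitrary: f g)
  case 0
  then show ?case by (auto intro: continuous_intros)
next
  case (Suc k)
  show ?case
  proof (rule Ck_on_SucI[OF assms])
    show "((\<lambda>x. f x + g x) has_derivative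
        (\<lambda>v. frechet_derivative f (at x) v + frechet_derivative g (at x) v)) (at x)" if "x \<in> U" for x
      using Suc.prems that by (intro derivative_intros has_derivative_frechet) auto
  qed (use Suc in auto)
qed

lemma Ck_on_bilinear:
  assumes "open U" "bounded_bilinear B"
  shows "Ck_on k U f \<Longrightarrow> Ck_on k U g \<Longrightarrow> Ck_on k U (\<lambda>x. B (f x) (g x))"
proof (induction k arbitrary: f g)
  case 0
  then show ?case using assms(2) by (auto intro: bounded_bilinear.continuous_on)
next
  case (Suc k)
  have lower: "Ck_on k U f" "Ck_on k U g"
    using Suc.prems by (auto dest: Ck_on_SucD simp del: Ck_on.simps)
  show ?case
  proof (rule Ck_on_SucI[OF assms(1)])
    show "((\<lambda>x. B (f x) (g x)) has_derivative
        (\<lambda>v. B (f x) (frechet_derivative g (at x) v) + B (frechet_derivative f (at x) v) (g x))) (at x)"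
      if "x \<in> U" for x
      using Suc.prems that by (intro bounded_bilinear.FDERIV[OF assms(2)] has_derivative_frechet) auto
    show "Ck_on k U (\<lambda>x. B (f x) (frechet_derivative g (at x) v) + B (frechet_derivative f (at x) v) (g x))"
      for v
      using Suc lower by (intro Ck_on_add[OF assms(1)] Suc.IH) auto
  qed
qed

lemma Ck_on_linear_comp:
  assumes "open U" "bounded_linear L"
  shows "Ck_on k U f \<Longrightarrow> Ck_on k U (\<lambda>x. L (f x))"
proof (induction k arbitrary: f)
  case 0
  then show ?case using assms(2) by (auto intro: bounded_linear.continuous_on)
next
  case (Suc k)
  show ?case
  proof (rule Ck_on_SucI[OF assms(1)])
    show "((\<lambda>x. L (f x)) has_derivative (\<lambda>v. L (frechet_derivative f (at x) v))) (at x)" if "x \<in> U" for x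
      using Suc.prems that by (intro bounded_linear.has_derivative[OF assms(2)] has_derivative_frechet) auto
  qed (use Suc in auto)
qed

lemma smooth_on_differentiable: "smooth_on U f \<Longrightarrow> x \<in> U \<Longrightarrow> f differentiable (at x)"
  unfolding smooth_on_def by (metis Ck_on.simps(2))

lemma smooth_on_has_derivative:
  "smooth_on U f \<Longrightarrow> x \<in> U \<Longrightarrow> (f has_derivative frechet_derivative f (at x)) (at x)"
  by (intro has_derivative_frechet smooth_on_differentiable)

lemma smooth_on_linear: "smooth_on U f \<Longrightarrow> x \<in> U \<Longrightarrow> linear (frechet_derivative f (at x))"
  by (intro linear_frechet_derivative smooth_on_differentiable)

lemma smooth_on_frechet_fixed: "smooth_on U f \<Longrightarrow> smooth_on U (\<lambda>x. frechet_derivative f (at x) v)"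
  unfolding smooth_on_def by (metis Ck_on.simps(2))

lemma smooth_on_cong: "open U \<Longrightarrow> smooth_on U f \<Longrightarrow> (\<And>x. x \<in> U \<Longrightarrow> f x = g x) \<Longrightarrow> smooth_on U g"
  unfolding smooth_on_def using Ck_on_cong[of U f g] by blast

lemma smooth_on_const: "smooth_on U (\<lambda>_. c)"
  by (simp add: smooth_on_def Ck_on_const)

lemma smooth_on_add: "open U \<Longrightarrow> smooth_on U f \<Longrightarrow> smooth_on U g \<Longrightarrow> smooth_on U (\<lambda>x. f x + g x)"
  by (simp add: smooth_on_def Ck_on_add)

lemma smooth_on_linear_comp:
  "bounded_linear L \<Longrightarrow> open U \<Longrightarrow> smooth_on U f \<Longrightarrow> smooth_on U (\<lambda>x. L (f x))"
  by (simp add: smooth_on_def Ck_on_linear_comp)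

lemmas smooth_on_minus = smooth_on_linear_comp[OF bounded_linear_minus[OF bounded_linear_ident]]
lemmas smooth_on_fst = smooth_on_linear_comp[OF bounded_linear_fst]
lemmas smooth_on_snd = smooth_on_linear_comp[OF bounded_linear_snd]
lemmas smooth_on_scaleR_right = smooth_on_linear_comp[OF bounded_linear_scaleR_right]

lemma smooth_on_diff: "open U \<Longrightarrow> smooth_on U f \<Longrightarrow> smooth_on U g \<Longrightarrow> smooth_on U (\<lambda>x. f x - g x)"
  using smooth_on_add[OF _ _ smooth_on_minus, of U f g] by simp

lemma smooth_on_scaleR:
  "open U \<Longrightarrow> smooth_on U f \<Longrightarrow> smooth_on U g \<Longrightarrow> smooth_on U (\<lambda>x. f x *\<^sub>R g x)"
  by (simp add: smooth_on_def Ck_on_bilinear[OF _ bounded_bilinear_scaleR])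

lemma smooth_on_Pair:
  assumes "open U" "smooth_on U f" "smooth_on U g" shows "smooth_on U (\<lambda>x. (f x, g x))"
proof -
  have "smooth_on U (\<lambda>x. (f x, 0) + (0, g x))"
    using assms
    by (intro smooth_on_add smooth_on_linear_comp[of "\<lambda>a. (a, 0)"] smooth_on_linear_comp[of "\<lambda>a. (0, a)"]
        bounded_linear_Pair bounded_linear_ident bounded_linear_zero)
  then show ?thesis by simp
qed

lemma smooth_on_sum:
  "open U \<Longrightarrow> (\<And>i. i \<in> I \<Longrightarrow> smooth_on U (f i)) \<Longrightarrow> smooth_on U (\<lambda>x. \<Sum>i\<in>I. f i x)"
  by (induction I rule: infinite_finite_induct) (auto intro: smooth_on_const smooth_on_add)

lemma linear_expand_Basis:
  fixes g :: "'a::euclidean_space \<Rightarrow> 'b::real_normed_vector"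
  assumes "linear g" shows "g v = (\<Sum>b\<in>Basis. (v \<bullet> b) *\<^sub>R g b)"
proof -
  have "g v = g (\<Sum>b\<in>Basis. (v \<bullet> b) *\<^sub>R b)" by (simp add: euclidean_representation)
  also have "\<dots> = (\<Sum>b\<in>Basis. (v \<bullet> b) *\<^sub>R g b)"
    using assms by (simp add: linear_sum linear_cmul)
  finally show ?thesis .
qed

text \<open>The derivative is expanded along a basis, since differentiability classes are defined through
  derivatives in fixed directions only; the same device is used for all derivatives in a moving direction.\<close>
lemma smooth_on_frechet:
  fixes f :: "'a::euclidean_space \<Rightarrow> 'b::real_normed_vector"
  assumes "open U" "smooth_on U f" "smooth_on U X"
  shows "smooth_on U (\<lambda>z. frechet_derivative f (at z) (X z))"
proof (rule smooth_on_cong[OF assms(1)])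
  show "smooth_on U (\<lambda>z. \<Sum>b\<in>Basis. (X z \<bullet> b) *\<^sub>R frechet_derivative f (at z) b)"
    using assms by (intro smooth_on_sum smooth_on_scaleR smooth_on_frechet_fixed
        smooth_on_linear_comp[of "\<lambda>v. v \<bullet> b" for b] bounded_linear_inner_left)
  show "(\<Sum>b\<in>Basis. (X x \<bullet> b) *\<^sub>R frechet_derivative f (at x) b) = frechet_derivative f (at x) (X x)"
    if "x \<in> U" for x
    by (rule linear_expand_Basis[OF smooth_on_linear[OF assms(2) that], symmetric])
qed

lemmas smooth_on_intros = smooth_on_const smooth_on_add smooth_on_diff smooth_on_minus smooth_on_fst
  smooth_on_snd smooth_on_scaleR smooth_on_scaleR_right smooth_on_Pair smooth_on_frechet

definition second_derivative ::
    "('a::real_normed_vector \<Rightarrow> 'b::real_normed_vector) \<Rightarrow> 'a \<Rightarrow> 'a \<Rightarrow> 'a \<Rightarrow> 'b" where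
  "second_derivative f z v w = frechet_derivative (\<lambda>x. frechet_derivative f (at x) v) (at z) w"

lemma second_derivative_expand:
  fixes f :: "'a::euclidean_space \<Rightarrow> 'b::real_normed_vector"
  assumes "open U" "smooth_on U f" "z \<in> U"
  shows "second_derivative f z v w = (\<Sum>b\<in>Basis. (v \<bullet> b) *\<^sub>R second_derivative f z b w)"
proof -
  have "((\<lambda>x. \<Sum>b\<in>Basis. (v \<bullet> b) *\<^sub>R frechet_derivative f (at x) b) has_derivative
      (\<lambda>w. \<Sum>b\<in>Basis. (v \<bullet> b) *\<^sub>R second_derivative f z b w)) (at z)"
    unfolding second_derivative_def
    by (intro derivative_intros smooth_on_has_derivative[OF smooth_on_frechet_fixed[OF assms(2)] assms(3)])
  then have "((\<lambda>x. frechet_derivative f (at x) v) has_derivative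
      (\<lambda>w. \<Sum>b\<in>Basis. (v \<bullet> b) *\<^sub>R second_derivative f z b w)) (at z)"
    by (rule has_derivative_transform_within_open[OF _ assms(1,3)])
      (simp add: linear_expand_Basis[OF smooth_on_linear[OF assms(2)], symmetric])
  then show ?thesis unfolding second_derivative_def by (rule frechet_eq)
qed

text \<open>Base point and direction of the inner derivative may both move. The case \<open>\<phi> = id\<close> serves the
  derivatives of Lie brackets, the case of the projection \<open>\<phi> = fst\<close> the coordinate changes of a tangent bundle.\<close>
lemma has_derivative_frechet_along:
  fixes f :: "'a::euclidean_space \<Rightarrow> 'b::real_normed_vector"
  assumes U: "open U" "smooth_on U f" "\<phi> z \<in> U"
    and \<phi>: "(\<phi> has_derivative \<phi>') (at z)" and X: "(X has_derivative X') (at z)"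
  shows "((\<lambda>x. frechet_derivative f (at (\<phi> x)) (X x)) has_derivative
    (\<lambda>w. second_derivative f (\<phi> z) (X z) (\<phi>' w) + frechet_derivative f (at (\<phi> z)) (X' w))) (at z)"
proof -
  have lin: "linear (frechet_derivative f (at (\<phi> z)))" by (rule smooth_on_linear[OF U(2,3)])
  have fin: "((\<lambda>x. \<Sum>b\<in>Basis. (X x \<bullet> b) *\<^sub>R frechet_derivative f (at (\<phi> x)) b) has_derivative
      (\<lambda>w. \<Sum>b\<in>Basis. (X z \<bullet> b) *\<^sub>R second_derivative f (\<phi> z) b (\<phi>' w)
         + (X' w \<bullet> b) *\<^sub>R frechet_derivative f (at (\<phi> z)) b)) (at z)"
    unfolding second_derivative_def
    by (intro derivative_intros X has_derivative_compose[OF \<phi>]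
        smooth_on_has_derivative[OF smooth_on_frechet_fixed[OF U(2)] U(3)])
  have "\<forall>\<^sub>F x in at z. \<phi> x \<in> U"
    using has_derivative_continuous[OF \<phi>] U(1,3) by (simp add: isCont_def topological_tendstoD)
  then have ev: "\<forall>\<^sub>F x in at z. (\<Sum>b\<in>Basis. (X x \<bullet> b) *\<^sub>R frechet_derivative f (at (\<phi> x)) b)
      = frechet_derivative f (at (\<phi> x)) (X x)"
    by (rule eventually_mono) (simp add: linear_expand_Basis[OF smooth_on_linear[OF U(2)], symmetric])
  have "((\<lambda>x. frechet_derivative f (at (\<phi> x)) (X x)) has_derivative
      (\<lambda>w. \<Sum>b\<in>Basis. (X z \<bullet> b) *\<^sub>R second_derivative f (\<phi> z) b (\<phi>' w)
         + (X' w \<bullet> b) *\<^sub>R frechet_derivative f (at (\<phi> z)) b)) (at z)"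
    by (rule has_derivative_transform_eventually[OF fin ev])
      (simp_all add: linear_expand_Basis[OF lin, symmetric])
  then show ?thesis
    by (simp add: sum.distrib linear_expand_Basis[OF lin, symmetric]
        second_derivative_expand[OF U, symmetric])
qed

lemma has_derivative_frechet_field:
  fixes f :: "'a::euclidean_space \<Rightarrow> 'b::real_normed_vector"
  assumes "open U" "smooth_on U f" "z \<in> U" "smooth_on U X"
  shows "((\<lambda>x. frechet_derivative f (at x) (X x)) has_derivative
    (\<lambda>w. second_derivative f z (X z) w + frechet_derivative f (at z) (frechet_derivative X (at z) w))) (at z)"
  using has_derivative_frechet_along[of U f "\<lambda>x. x" z "\<lambda>x. x" X "frechet_derivative X (at z)"]
    smooth_on_has_derivative[OF assms(4,3)] assms by simp

text \<open>The second difference quotient of \<open>f\<close> along \<open>v\<close> and \<open>w\<close> is symmetric in \<open>v\<close> and \<open>w\<close>; by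
  two applications of the mean value theorem it equals a value of the iterated derivative close to
  the base point, so both orders of differentiation have the same limit.\<close>

lemma second_difference_mvt:
  fixes f :: "'a::euclidean_space \<Rightarrow> real"
  assumes U: "open U" "smooth_on U f" and h: "0 < h"
    and sub: "\<And>s t. \<lbrakk>0 \<le> s; s \<le> h; 0 \<le> t; t \<le> h\<rbrakk> \<Longrightarrow> z + s *\<^sub>R v + t *\<^sub>R w \<in> U"
  obtains s t where "0 < s" "s < h" "0 < t" "t < h"
    "f (z + h *\<^sub>R v + h *\<^sub>R w) - f (z + h *\<^sub>R v) - f (z + h *\<^sub>R w) + f z
      = h * h * second_derivative f (z + s *\<^sub>R v + t *\<^sub>R w) v w"
proof -
  define g where "g s = f (z + s *\<^sub>R v + h *\<^sub>R w) - f (z + s *\<^sub>R v + 0 *\<^sub>R w)" for s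
  have fd: "((\<lambda>s. f (z + s *\<^sub>R v + t *\<^sub>R w)) has_derivative
      (\<lambda>r. frechet_derivative f (at (z + s *\<^sub>R v + t *\<^sub>R w)) (r *\<^sub>R v))) (at s)"
    if "0 \<le> s" "s \<le> h" "0 \<le> t" "t \<le> h" for s t
    using that
    by (intro has_derivative_compose[where g = f and f = "\<lambda>s. z + s *\<^sub>R v + t *\<^sub>R w"]
        smooth_on_has_derivative[OF U(2) sub]) (auto intro!: derivative_eq_intros)
  have fd': "((\<lambda>s. f (z + s *\<^sub>R v + t *\<^sub>R w)) has_field_derivative
      frechet_derivative f (at (z + s *\<^sub>R v + t *\<^sub>R w)) v) (at s)"
    if "0 \<le> s" "s \<le> h" "0 \<le> t" "t \<le> h" for s t
    unfolding has_field_derivative_def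
    by (rule has_derivative_eq_rhs[OF fd[OF that]])
      (simp add: fun_eq_iff linear_cmul[OF smooth_on_linear[OF U(2) sub[OF that]]])
  have gd: "(g has_field_derivative frechet_derivative f (at (z + s *\<^sub>R v + h *\<^sub>R w)) v
      - frechet_derivative f (at (z + s *\<^sub>R v + 0 *\<^sub>R w)) v) (at s)" if "0 \<le> s" "s \<le> h" for s
    unfolding g_def using that h by (intro DERIV_diff fd') auto
  from MVT2[OF h gd] obtain s where s: "0 < s" "s < h"
    and gs: "g h - g 0 = (h - 0) * (frechet_derivative f (at (z + s *\<^sub>R v + h *\<^sub>R w)) v
      - frechet_derivative f (at (z + s *\<^sub>R v + 0 *\<^sub>R w)) v)" by blast
  define k where "k t = frechet_derivative f (at (z + s *\<^sub>R v + t *\<^sub>R w)) v" for t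
  have kd: "(k has_field_derivative second_derivative f (z + s *\<^sub>R v + t *\<^sub>R w) v w) (at t)"
    if t: "0 \<le> t" "t \<le> h" for t
  proof -
    have in': "z + s *\<^sub>R v + t *\<^sub>R w \<in> U" using s t by (intro sub) auto
    have D: "smooth_on U (\<lambda>x. frechet_derivative f (at x) v)" by (rule smooth_on_frechet_fixed[OF U(2)])
    have "(k has_derivative (\<lambda>r. frechet_derivative (\<lambda>x. frechet_derivative f (at x) v)
        (at (z + s *\<^sub>R v + t *\<^sub>R w)) (r *\<^sub>R w))) (at t)"
      unfolding k_def
      by (intro has_derivative_compose[where g = "\<lambda>x. frechet_derivative f (at x) v"
            and f = "\<lambda>t. z + s *\<^sub>R v + t *\<^sub>R w"] smooth_on_has_derivative[OF D in'])
        (auto intro!: derivative_eq_intros)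
    then show ?thesis unfolding has_field_derivative_def second_derivative_def
      by (rule has_derivative_eq_rhs) (simp add: fun_eq_iff linear_cmul[OF smooth_on_linear[OF D in']])
  qed
  from MVT2[OF h kd] obtain t where t: "0 < t" "t < h"
    and kt: "k h - k 0 = (h - 0) * second_derivative f (z + s *\<^sub>R v + t *\<^sub>R w) v w" by blast
  have "f (z + h *\<^sub>R v + h *\<^sub>R w) - f (z + h *\<^sub>R v) - f (z + h *\<^sub>R w) + f z
      = h * h * second_derivative f (z + s *\<^sub>R v + t *\<^sub>R w) v w"
    using gs kt unfolding g_def k_def by simp
  with s t that show ?thesis by blast
qed

lemma second_difference_tendsto:
  fixes f :: "'a::euclidean_space \<Rightarrow> real"
  assumes U: "open U" "smooth_on U f" "z \<in> U"
  shows "((\<lambda>h. (f (z + h *\<^sub>R v + h *\<^sub>R w) - f (z + h *\<^sub>R v) - f (z + h *\<^sub>R w) + f z) / (h * h))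
    \<longlongrightarrow> second_derivative f z v w) (at_right 0)"
proof (rule tendstoI)
  fix e :: real assume "0 < e"
  let ?D = "\<lambda>x. second_derivative f x v w"
  have "continuous_on U ?D"
    unfolding second_derivative_def
    using smooth_on_frechet_fixed[OF smooth_on_frechet_fixed[OF U(2)]] smooth_on_def Ck_on.simps(1) by blast
  then have "isCont ?D z" using U by (simp add: continuous_on_eq_continuous_at)
  then obtain d1 where d1: "d1 > 0" "\<And>x. dist x z < d1 \<Longrightarrow> dist (?D x) (?D z) < e"
    using \<open>0 < e\<close> unfolding continuous_at_eps_delta by blast
  obtain d2 where d2: "d2 > 0" "ball z d2 \<subseteq> U" using U openE by blast
  define m where "m = norm v + norm w + 1"
  define d where "d = min d1 d2 / m"
  have m: "m > 0" unfolding m_def using norm_ge_zero[of v] norm_ge_zero[of w] by linarith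
  have d: "d > 0" unfolding d_def using d1 d2 m by simp
  have close: "dist (z + s *\<^sub>R v + t *\<^sub>R w) z < min d1 d2"
    if "0 \<le> s" "s \<le> h" "0 \<le> t" "t \<le> h" "h < d" for s t h
  proof -
    have "dist (z + s *\<^sub>R v + t *\<^sub>R w) z = norm (s *\<^sub>R v + t *\<^sub>R w)" by (simp add: dist_norm add.assoc)
    also have "\<dots> \<le> s * norm v + t * norm w"
      using norm_triangle_ineq[of "s *\<^sub>R v" "t *\<^sub>R w"] that by simp
    also have "\<dots> \<le> h * norm v + h * norm w" using that by (intro add_mono mult_right_mono) auto
    also have "\<dots> \<le> h * m" unfolding m_def using that by (simp add: algebra_simps)
    also have "\<dots> < d * m" using that m by simp
    also have "\<dots> = min d1 d2" unfolding d_def using m by simp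
    finally show ?thesis .
  qed
  have "dist ((f (z + h *\<^sub>R v + h *\<^sub>R w) - f (z + h *\<^sub>R v) - f (z + h *\<^sub>R w) + f z) / (h * h)) (?D z) < e"
    if h: "0 < h" "h < d" for h
  proof -
    have sub: "z + s *\<^sub>R v + t *\<^sub>R w \<in> U" if "0 \<le> s" "s \<le> h" "0 \<le> t" "t \<le> h" for s t
      using close[OF that h(2)] d2(2) by (auto simp: dist_commute)
    obtain s t where st: "0 < s" "s < h" "0 < t" "t < h"
      and eq: "f (z + h *\<^sub>R v + h *\<^sub>R w) - f (z + h *\<^sub>R v) - f (z + h *\<^sub>R w) + f z
        = h * h * second_derivative f (z + s *\<^sub>R v + t *\<^sub>R w) v w"
      by (rule second_difference_mvt[OF U(1,2) h(1) sub])
    have "dist (?D (z + s *\<^sub>R v + t *\<^sub>R w)) (?D z) < e"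
      using close[of s h t] st h by (intro d1(2)) auto
    then show ?thesis unfolding eq using h by simp
  qed
  then show "\<forall>\<^sub>F h in at_right 0. dist ((f (z + h *\<^sub>R v + h *\<^sub>R w) - f (z + h *\<^sub>R v)
      - f (z + h *\<^sub>R w) + f z) / (h * h)) (?D z) < e"
    unfolding eventually_at_right_field using d by blast
qed

lemma second_derivative_symmetric:
  fixes f :: "'a::euclidean_space \<Rightarrow> 'b::euclidean_space"
  assumes U: "open U" "smooth_on U f" "z \<in> U"
  shows "second_derivative f z v w = second_derivative f z w v"
proof (rule euclidean_eqI)
  fix b :: 'b
  let ?g = "\<lambda>x. f x \<bullet> b"
  have g: "smooth_on U ?g"
    using U by (intro smooth_on_linear_comp[of "\<lambda>v. v \<bullet> b"] bounded_linear_inner_left)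
  have first: "frechet_derivative ?g (at x) v = frechet_derivative f (at x) v \<bullet> b" if "x \<in> U" for x v
    by (rule frechet_eq) (intro derivative_intros smooth_on_has_derivative[OF U(2) that])
  have comp: "second_derivative ?g z v w = second_derivative f z v w \<bullet> b" for v w
  proof -
    have "((\<lambda>x. frechet_derivative f (at x) v \<bullet> b) has_derivative
        (\<lambda>w. second_derivative f z v w \<bullet> b)) (at z)"
      unfolding second_derivative_def
      by (intro derivative_intros smooth_on_has_derivative[OF smooth_on_frechet_fixed[OF U(2)] U(3)])
    then have "((\<lambda>x. frechet_derivative ?g (at x) v) has_derivative
        (\<lambda>w. second_derivative f z v w \<bullet> b)) (at z)"
      by (rule has_derivative_transform_within_open[OF _ U(1,3)]) (simp add: first)
    then show ?thesis unfolding second_derivative_def[of ?g] by (rule frechet_eq)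
  qed
  have "second_derivative ?g z v w = second_derivative ?g z w v"
  proof (rule tendsto_unique[OF trivial_limit_at_right_real second_difference_tendsto[OF U(1) g U(3)]])
    show "((\<lambda>h. (?g (z + h *\<^sub>R v + h *\<^sub>R w) - ?g (z + h *\<^sub>R v) - ?g (z + h *\<^sub>R w) + ?g z) / (h * h))
        \<longlongrightarrow> second_derivative ?g z w v) (at_right 0)"
      using second_difference_tendsto[OF U(1) g U(3), of w v] by (simp add: algebra_simps)
  qed
  then show "second_derivative f z v w \<bullet> b = second_derivative f z w v \<bullet> b"
    by (simp add: comp)
qed

section \<open>Vector fields in charts\<close>

text \<open>Only the charts enter, not a topology on the underlying set, so that a surface and its slit
  tangent bundle, which comes without a topology, are both instances.\<close>
locale smooth_atlas =
  fixes B :: "('p, 'e::euclidean_space) chart set"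
  assumes chart_inj: "c \<in> B \<Longrightarrow> inj_on (snd c) (fst c)"
    and open_image: "c \<in> B \<Longrightarrow> open (snd c ` fst c)"
    and open_overlap: "c \<in> B \<Longrightarrow> d \<in> B \<Longrightarrow> open (snd c ` (fst c \<inter> fst d))"
    and transition_differentiable:
      "c \<in> B \<Longrightarrow> d \<in> B \<Longrightarrow> p \<in> fst c \<inter> fst d \<Longrightarrow> transition c d differentiable (at (snd c p))"
begin

abbreviation lie :: "('p, 'e) vfield \<Rightarrow> ('p, 'e) vfield \<Rightarrow> ('p, 'e) vfield" where
  "lie \<equiv> lie_bracket B"

text \<open>Brackets only see the values of a field at a point in charts around that point, so fields are
  compared there only; brackets of such fields are then equal as functions (\<open>lie_cong\<close>).\<close>
definition same :: "('p, 'e) vfield \<Rightarrow> ('p, 'e) vfield \<Rightarrow> bool" (infix "\<simeq>" 50) where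
  "X \<simeq> Y \<longleftrightarrow> (\<forall>c\<in>B. \<forall>p\<in>fst c. X p c = Y p c)"

definition smooth_field :: "('p, 'e) vfield \<Rightarrow> bool" where
  "smooth_field X \<longleftrightarrow> (\<forall>c\<in>B. smooth_on (snd c ` fst c) (vf_rep c X))"

text \<open>The coordinate form of \<open>X(f)\<close>. Unlike \<open>vf_apply\<close> it involves no choice of a chart, so product
  rules hold for it without assuming that \<open>X\<close> is tangent.\<close>
definition chart_deriv :: "('p, 'e) chart \<Rightarrow> ('p, 'e) vfield \<Rightarrow> ('p \<Rightarrow> real) \<Rightarrow> 'p \<Rightarrow> real" where
  "chart_deriv c X f p = frechet_derivative (f \<circ> chart_inv c) (at (snd c p)) (X p c)"

lemma chart_inv_chart [simp]: "c \<in> B \<Longrightarrow> p \<in> fst c \<Longrightarrow> chart_inv c (snd c p) = p"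
  unfolding chart_inv_def by (rule the_inv_into_f_f[OF chart_inj])

lemma vf_rep_at: "c \<in> B \<Longrightarrow> p \<in> fst c \<Longrightarrow> vf_rep c X (snd c p) = X p c"
  by (simp add: vf_rep_def)

lemma same_at: "X \<simeq> Y \<Longrightarrow> c \<in> B \<Longrightarrow> p \<in> fst c \<Longrightarrow> X p c = Y p c"
  by (simp add: same_def)

lemma same_sym: "X \<simeq> Y \<Longrightarrow> Y \<simeq> X"
  by (simp add: same_def)

lemma same_refl: "X \<simeq> X"
  by (simp add: same_def)

lemma same_trans: "X \<simeq> Y \<Longrightarrow> Y \<simeq> Z \<Longrightarrow> X \<simeq> Z"
  by (simp add: same_def)

lemma same_uminus: "X \<simeq> Y \<Longrightarrow> - X \<simeq> - Y"
  by (simp add: same_def)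

lemma in_carrier: "c \<in> B \<Longrightarrow> p \<in> fst c \<Longrightarrow> p \<in> carrier_of B"
  by (auto simp: carrier_of_def)

lemma vf_rep_cong: "X \<simeq> Y \<Longrightarrow> c \<in> B \<Longrightarrow> z \<in> snd c ` fst c \<Longrightarrow> vf_rep c X z = vf_rep c Y z"
  by (auto simp: vf_rep_at same_at)

lemma eq_on_same: "eq_on (carrier_of B) X Y \<Longrightarrow> X \<simeq> Y"
  by (auto simp: same_def eq_on_def in_carrier)

lemma smooth_fieldD: "smooth_field X \<Longrightarrow> c \<in> B \<Longrightarrow> smooth_on (snd c ` fst c) (vf_rep c X)"
  by (simp add: smooth_field_def)

lemma smooth_fieldI:
  assumes "\<And>c. c \<in> B \<Longrightarrow> smooth_on (snd c ` fst c) (f c)"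
    and "\<And>c p. c \<in> B \<Longrightarrow> p \<in> fst c \<Longrightarrow> X p c = f c (snd c p)"
  shows "smooth_field X"
  unfolding smooth_field_def
proof
  fix c assume c: "c \<in> B"
  show "smooth_on (snd c ` fst c) (vf_rep c X)"
    by (rule smooth_on_cong[OF open_image[OF c] assms(1)[OF c]]) (use c assms(2)[OF c] in \<open>auto simp: vf_rep_at\<close>)
qed

lemma smooth_field_cong: "X \<simeq> Y \<Longrightarrow> smooth_field X \<Longrightarrow> smooth_field Y"
  by (rule smooth_fieldI[where f = "\<lambda>c. vf_rep c X"])
    (simp_all add: smooth_field_def vf_rep_at same_at)

lemma field_differentiable:
  "smooth_field X \<Longrightarrow> c \<in> B \<Longrightarrow> p \<in> fst c \<Longrightarrow>
    (vf_rep c X has_derivative frechet_derivative (vf_rep c X) (at (snd c p))) (at (snd c p))"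
  by (rule smooth_on_has_derivative[OF smooth_fieldD]) auto

lemma field_derivative_linear:
  "smooth_field X \<Longrightarrow> c \<in> B \<Longrightarrow> p \<in> fst c \<Longrightarrow> linear (frechet_derivative (vf_rep c X) (at (snd c p)))"
  by (rule smooth_on_linear[OF smooth_fieldD]) auto

lemma function_differentiable:
  "smooth_function B f \<Longrightarrow> c \<in> B \<Longrightarrow> p \<in> fst c \<Longrightarrow>
    ((f \<circ> chart_inv c) has_derivative frechet_derivative (f \<circ> chart_inv c) (at (snd c p))) (at (snd c p))"
  unfolding smooth_function_def by (intro smooth_on_has_derivative) auto

lemma field_derivative_cong:
  assumes "X \<simeq> Y" "c \<in> B" "p \<in> fst c"
  shows "frechet_derivative (vf_rep c X) (at (snd c p)) = frechet_derivative (vf_rep c Y) (at (snd c p))"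
proof -
  have "(vf_rep c X has_derivative D) (at (snd c p)) \<longleftrightarrow> (vf_rep c Y has_derivative D) (at (snd c p))" for D
    using has_derivative_transform_within_open[of _ D "snd c p" UNIV "snd c ` fst c"]
      vf_rep_cong[OF assms(1,2)] open_image[OF assms(2)] assms(3) by (metis imageI)
  then show ?thesis by (simp add: frechet_derivative_def)
qed

lemma lie_at:
  "c \<in> B \<Longrightarrow> p \<in> fst c \<Longrightarrow> lie X Y p c =
    frechet_derivative (vf_rep c Y) (at (snd c p)) (X p c)
    - frechet_derivative (vf_rep c X) (at (snd c p)) (Y p c)"
  by (simp add: lie_bracket_def)

lemma lie_off: "\<not> (c \<in> B \<and> p \<in> fst c) \<Longrightarrow> lie X Y p c = 0"
  by (auto simp: lie_bracket_def)

lemma field_eqI: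
  assumes "\<And>p c. c \<in> B \<Longrightarrow> p \<in> fst c \<Longrightarrow> X p c = Y p c"
    and "\<And>p c. \<not> (c \<in> B \<and> p \<in> fst c) \<Longrightarrow> X p c = Y p c"
  shows "X = Y"
  using assms by blast

lemma lie_cong:
  assumes "X \<simeq> X'" "Y \<simeq> Y'" shows "lie X Y = lie X' Y'"
  by (rule field_eqI)
    (use assms in \<open>auto simp: lie_at lie_off field_derivative_cong[OF assms(1)]
      field_derivative_cong[OF assms(2)] same_at\<close>)

lemma lie_antisym: "lie X Y = - lie Y X"
  by (rule field_eqI) (auto simp: lie_at lie_off)

lemma vf_rep_lie:
  assumes "c \<in> B" "z \<in> snd c ` fst c"
  shows "vf_rep c (lie X Y) z = frechet_derivative (vf_rep c Y) (at z) (vf_rep c X z)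
    - frechet_derivative (vf_rep c X) (at z) (vf_rep c Y z)"
  using assms by (auto simp: vf_rep_at lie_at)

lemma smooth_lie:
  assumes "smooth_field X" "smooth_field Y" shows "smooth_field (lie X Y)"
  by (rule smooth_fieldI[where f = "\<lambda>c z. frechet_derivative (vf_rep c Y) (at z) (vf_rep c X z)
      - frechet_derivative (vf_rep c X) (at z) (vf_rep c Y z)"])
    (auto simp: lie_at vf_rep_at intro!: smooth_on_intros smooth_fieldD open_image assms)

lemma smooth_add: "smooth_field X \<Longrightarrow> smooth_field Y \<Longrightarrow> smooth_field (X + Y)"
  by (rule smooth_fieldI[where f = "\<lambda>c z. vf_rep c X z + vf_rep c Y z"])
    (auto simp: vf_rep_at intro!: smooth_on_intros smooth_fieldD open_image)

lemma smooth_uminus: "smooth_field X \<Longrightarrow> smooth_field (- X)"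
  by (rule smooth_fieldI[where f = "\<lambda>c z. - vf_rep c X z"])
    (auto simp: vf_rep_at intro!: smooth_on_intros smooth_fieldD open_image)

lemma smooth_diff: "smooth_field X \<Longrightarrow> smooth_field Y \<Longrightarrow> smooth_field (X - Y)"
  using smooth_add[OF _ smooth_uminus, of X Y] by simp

lemma smooth_scale: "smooth_function B f \<Longrightarrow> smooth_field X \<Longrightarrow> smooth_field (f \<odot> X)"
  by (rule smooth_fieldI[where f = "\<lambda>c z. (f \<circ> chart_inv c) z *\<^sub>R vf_rep c X z"])
    (simp_all add: vf_rep_at vf_scale_def smooth_on_scaleR smooth_function_def smooth_fieldD open_image del: o_apply,
     simp)

lemma smooth_zero: "smooth_field 0"
  by (rule smooth_fieldI[where f = "\<lambda>c z. 0"]) (auto intro: smooth_on_const)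

lemma vf_rep_add: "vf_rep c (X + Y) = (\<lambda>z. vf_rep c X z + vf_rep c Y z)"
  by (simp add: vf_rep_def fun_eq_iff)

lemma vf_rep_scale: "vf_rep c (f \<odot> X) = (\<lambda>z. (f \<circ> chart_inv c) z *\<^sub>R vf_rep c X z)"
  by (simp add: vf_rep_def vf_scale_def fun_eq_iff)

lemma derivative_add:
  assumes "smooth_field X" "smooth_field Y" "c \<in> B" "p \<in> fst c"
  shows "frechet_derivative (vf_rep c (X + Y)) (at (snd c p)) w =
    frechet_derivative (vf_rep c X) (at (snd c p)) w + frechet_derivative (vf_rep c Y) (at (snd c p)) w"
  unfolding vf_rep_add by (rule frechet_eq) (intro derivative_intros field_differentiable assms)

lemma derivative_scale:
  assumes "smooth_function B f" "smooth_field X" "c \<in> B" "p \<in> fst c"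
  shows "frechet_derivative (vf_rep c (f \<odot> X)) (at (snd c p)) w =
    frechet_derivative (f \<circ> chart_inv c) (at (snd c p)) w *\<^sub>R X p c
      + f p *\<^sub>R frechet_derivative (vf_rep c X) (at (snd c p)) w"
  unfolding vf_rep_scale
  by (rule trans[OF frechet_eq[OF has_derivative_scaleR[OF function_differentiable[OF assms(1,3,4)]
        field_differentiable[OF assms(2-4)]]]])
    (use assms in \<open>simp add: vf_rep_at add.commute\<close>)

lemma lie_add_right:
  assumes "smooth_field X" "smooth_field Y" "smooth_field Z" "c \<in> B" "p \<in> fst c"
  shows "lie X (Y + Z) p c = lie X Y p c + lie X Z p c"
  using assms
  by (simp add: lie_at derivative_add linear_add[OF field_derivative_linear] algebra_simps)

lemma lie_scale_right:
  assumes "smooth_field X" "smooth_function B f" "smooth_field Y" "c \<in> B" "p \<in> fst c"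
  shows "lie X (f \<odot> Y) p c = chart_deriv c X f p *\<^sub>R Y p c + f p *\<^sub>R lie X Y p c"
proof -
  have "(f \<odot> Y) p c = f p *\<^sub>R Y p c" by (simp add: vf_scale_def)
  then show ?thesis
    using assms by (simp add: lie_at derivative_scale chart_deriv_def
      linear_cmul[OF field_derivative_linear] algebra_simps)
qed

text \<open>In a chart the second derivatives of each field occur twice with opposite signs, up to the order
  of differentiation, and the products of first derivatives cancel.\<close>
lemma lie_jacobi:
  assumes X: "smooth_field X" and Y: "smooth_field Y" and Z: "smooth_field Z"
  shows "lie X (lie Y Z) = lie (lie X Y) Z + lie Y (lie X Z)"
proof (rule field_eqI)
  fix p c assume c: "c \<in> B" "p \<in> fst c"
  let ?U = "snd c ` fst c" and ?z = "snd c p"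
  note sm = smooth_fieldD[OF X c(1)] smooth_fieldD[OF Y c(1)] smooth_fieldD[OF Z c(1)]
  have z: "?z \<in> ?U" using c by blast
  note U = open_image[OF c(1)]
  have deriv_lie: "frechet_derivative (vf_rep c (lie V W)) (at ?z) w =
      second_derivative (vf_rep c W) ?z (V p c) w
      + frechet_derivative (vf_rep c W) (at ?z) (frechet_derivative (vf_rep c V) (at ?z) w)
      - (second_derivative (vf_rep c V) ?z (W p c) w
      + frechet_derivative (vf_rep c V) (at ?z) (frechet_derivative (vf_rep c W) (at ?z) w))"
    if V: "smooth_field V" and W: "smooth_field W" for V W w
  proof (rule frechet_eq)
    note sm = smooth_fieldD[OF V c(1)] smooth_fieldD[OF W c(1)]
    have "((\<lambda>z. frechet_derivative (vf_rep c W) (at z) (vf_rep c V z)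
        - frechet_derivative (vf_rep c V) (at z) (vf_rep c W z)) has_derivative (\<lambda>w.
      second_derivative (vf_rep c W) ?z (vf_rep c V ?z) w
      + frechet_derivative (vf_rep c W) (at ?z) (frechet_derivative (vf_rep c V) (at ?z) w)
      - (second_derivative (vf_rep c V) ?z (vf_rep c W ?z) w
      + frechet_derivative (vf_rep c V) (at ?z) (frechet_derivative (vf_rep c W) (at ?z) w)))) (at ?z)"
      by (intro has_derivative_diff has_derivative_frechet_field[OF U _ z] sm)
    then show "(vf_rep c (lie V W) has_derivative (\<lambda>w.
      second_derivative (vf_rep c W) ?z (V p c) w
      + frechet_derivative (vf_rep c W) (at ?z) (frechet_derivative (vf_rep c V) (at ?z) w)
      - (second_derivative (vf_rep c V) ?z (W p c) w
      + frechet_derivative (vf_rep c V) (at ?z) (frechet_derivative (vf_rep c W) (at ?z) w)))) (at ?z)"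
      unfolding vf_rep_at[OF c]
      by (rule has_derivative_transform_within_open[OF _ U z]) (simp add: vf_rep_lie[OF c(1)])
  qed
  note lin = linear_diff[OF field_derivative_linear[OF _ c]]
  note sym = second_derivative_symmetric[OF U _ z]
  show "lie X (lie Y Z) p c = (lie (lie X Y) Z + lie Y (lie X Z)) p c"
    using sym[OF sm(1), of "Y p c" "Z p c"] sym[OF sm(2), of "X p c" "Z p c"]
      sym[OF sm(3), of "X p c" "Y p c"]
    by (simp add: lie_at[OF c] deriv_lie X Y Z lin)
qed (simp add: lie_off)

text \<open>The coordinate vectors of a tangent vector are related by the derivative of the coordinate
  change, which the chain rule also produces in the derivative of \<open>f\<close>.\<close>
lemma vf_apply_chart:
  assumes X: "X p \<in> tangent_space B p" and f: "smooth_function B f" and c: "c \<in> B" "p \<in> fst c"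
  shows "vf_apply B X f p = chart_deriv c X f p"
proof -
  define d where "d = (SOME d. d \<in> B \<and> p \<in> fst d)"
  have d: "d \<in> B" "p \<in> fst d"
    using someI_ex[of "\<lambda>d. d \<in> B \<and> p \<in> fst d"] c unfolding d_def by blast+
  let ?t = "transition c d"
  have tz: "?t (snd c q) = snd d q" if "q \<in> fst c \<inter> fst d" for q
    using that c by (simp add: transition_def)
  have "((\<lambda>z. (f \<circ> chart_inv d) (?t z)) has_derivative
      (\<lambda>w. frechet_derivative (f \<circ> chart_inv d) (at (snd d p)) (frechet_derivative ?t (at (snd c p)) w)))
      (at (snd c p))"
    by (rule has_derivative_compose[where g = "f \<circ> chart_inv d"])
      (use transition_differentiable[OF c(1) d(1), of p] function_differentiable[OF f d] c d tz[of p]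
        in \<open>simp_all add: has_derivative_frechet del: o_apply\<close>)
  then have "((f \<circ> chart_inv c) has_derivative
      (\<lambda>w. frechet_derivative (f \<circ> chart_inv d) (at (snd d p)) (frechet_derivative ?t (at (snd c p)) w)))
      (at (snd c p))"
    by (rule has_derivative_transform_within_open[OF _ open_overlap[OF c(1) d(1)]])
      (use c d tz in auto)
  moreover have "X p d = frechet_derivative ?t (at (snd c p)) (X p c)"
    using X c d unfolding tangent_space_def by blast
  ultimately show ?thesis
    unfolding vf_apply_def chart_deriv_def Let_def d_def[symmetric] by (simp add: frechet_eq)
qed

lemma smooth_chart_deriv:
  assumes "smooth_field X" "smooth_function B f"
    and "\<And>c p. c \<in> B \<Longrightarrow> p \<in> fst c \<Longrightarrow> g p = chart_deriv c X f p"
  shows "smooth_function B g"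
  unfolding smooth_function_def
proof
  fix c assume c: "c \<in> B"
  show "smooth_on (snd c ` fst c) (g \<circ> chart_inv c)"
  proof (rule smooth_on_cong[OF open_image[OF c]])
    show "smooth_on (snd c ` fst c) (\<lambda>z. frechet_derivative (f \<circ> chart_inv c) (at z) (vf_rep c X z))"
      using assms c by (intro smooth_on_frechet smooth_fieldD open_image) (auto simp: smooth_function_def)
  next
    fix z assume "z \<in> snd c ` fst c"
    then obtain p where p: "p \<in> fst c" "z = snd c p" by blast
    show "frechet_derivative (f \<circ> chart_inv c) (at z) (vf_rep c X z) = (g \<circ> chart_inv c) z"
      using assms(3)[OF c p(1)] c p by (simp add: chart_deriv_def vf_rep_at)
  qed
qed

lemma smooth_function_mult:
  assumes "smooth_function B f" "smooth_function B g" shows "smooth_function B (f * g)"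
  unfolding smooth_function_def
proof
  fix c assume c: "c \<in> B"
  show "smooth_on (snd c ` fst c) (f * g \<circ> chart_inv c)"
    using smooth_on_scaleR[OF open_image[OF c], of "f \<circ> chart_inv c" "g \<circ> chart_inv c"] assms c
    by (simp add: smooth_function_def o_def)
qed

end

section \<open>The slit tangent bundle\<close>

lemma smooth_manifold_atlas:
  assumes "smooth_manifold M A" shows "smooth_atlas A"
proof
  have chart: "openin M (fst c)" "open (snd c ` fst c)"
    "homeomorphic_map (subtopology M (fst c)) (top_of_set (snd c ` fst c)) (snd c)" if "c \<in> A" for c
    using assms that by (auto simp: smooth_manifold_def)
  have top: "topspace (subtopology M (fst c)) = fst c" if "c \<in> A" for c
    by (rule topspace_subtopology_subset[OF openin_subset[OF chart(1)[OF that]]])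
  show "inj_on (snd c) (fst c)" if "c \<in> A" for c
    using homeomorphic_imp_injective_map[OF chart(3)[OF that]] top[OF that] by simp
  show "open (snd c ` fst c)" if "c \<in> A" for c by (rule chart(2)[OF that])
  show "open (snd c ` (fst c \<inter> fst d))" if c: "c \<in> A" and d: "d \<in> A" for c d
  proof -
    have "openin (subtopology M (fst c)) (fst c \<inter> fst d)"
      using chart(1)[OF d] by (auto simp: openin_subtopology)
    then have "openin (top_of_set (snd c ` fst c)) (snd c ` (fst c \<inter> fst d))"
      using homeomorphic_imp_open_map[OF chart(3)[OF c]] unfolding open_map_def by blast
    then show ?thesis using chart(2)[OF c] openin_open_trans by blast
  qed
  show "transition c d differentiable (at (snd c p))" if "c \<in> A" "d \<in> A" "p \<in> fst c \<inter> fst d" for c d p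
    using assms that unfolding smooth_manifold_def by (intro smooth_on_differentiable) auto
qed

lemma tangent_space_eqI:
  assumes "v \<in> tangent_space A p" "w \<in> tangent_space A p" "c \<in> A" "p \<in> fst c" "v c = w c"
  shows "v = w"
proof
  fix d
  show "v d = w d"
  proof (cases "d \<in> A \<and> p \<in> fst d")
    case True
    then have "v d = frechet_derivative (transition c d) (at (snd c p)) (v c)"
      "w d = frechet_derivative (transition c d) (at (snd c p)) (w c)"
      using assms unfolding tangent_space_def by blast+
    then show ?thesis using assms(5) by simp
  next
    case False
    then have "v d = 0" "w d = 0" using assms(1,2) unfolding tangent_space_def by blast+
    then show ?thesis by simp
  qed
qed

context smooth_atlas
begin

lemma transition_chart:
  "c \<in> B \<Longrightarrow> p \<in> fst c \<Longrightarrow> transition c d (snd c p) = snd d p"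
  by (simp add: transition_def)

lemma transition_has_derivative:
  "c \<in> B \<Longrightarrow> d \<in> B \<Longrightarrow> p \<in> fst c \<Longrightarrow> p \<in> fst d \<Longrightarrow>
    (transition c d has_derivative frechet_derivative (transition c d) (at (snd c p))) (at (snd c p))"
  by (intro has_derivative_frechet transition_differentiable) auto

lemma transition_cocycle:
  assumes "c \<in> B" "d \<in> B" "e \<in> B" "p \<in> fst c" "p \<in> fst d" "p \<in> fst e"
  shows "frechet_derivative (transition c e) (at (snd c p)) y =
    frechet_derivative (transition d e) (at (snd d p)) (frechet_derivative (transition c d) (at (snd c p)) y)"
proof (rule frechet_eq)
  have "((\<lambda>z. transition d e (transition c d z)) has_derivative (\<lambda>y. frechet_derivative (transition d e)
      (at (snd d p)) (frechet_derivative (transition c d) (at (snd c p)) y))) (at (snd c p))"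
    using transition_has_derivative[OF assms(2,3,5,6)]
    by (intro has_derivative_compose[where g = "transition d e",
          OF transition_has_derivative[OF assms(1,2,4,5)]])
      (simp add: transition_chart[OF assms(1,4)])
  then show "(transition c e has_derivative (\<lambda>y. frechet_derivative (transition d e) (at (snd d p))
      (frechet_derivative (transition c d) (at (snd c p)) y))) (at (snd c p))"
    by (rule has_derivative_transform_within_open[OF _ open_overlap[OF assms(1,2)]])
      (use assms in \<open>auto simp: transition_chart\<close>)
qed

lemma transition_self:
  assumes "c \<in> B" "p \<in> fst c"
  shows "frechet_derivative (transition c c) (at (snd c p)) y = y"
proof (rule frechet_eq)
  show "(transition c c has_derivative (\<lambda>y. y)) (at (snd c p))"
    by (rule has_derivative_transform_within_open[OF has_derivative_ident open_image[OF assms(1)]])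
      (use assms in \<open>auto simp: transition_chart\<close>)
qed

text \<open>The cocycle rule for derivatives of coordinate changes makes the transported family a tangent
  vector. This is why the induced charts have all of \<open>U \<times> (\<real>\<^sup>2 - 0)\<close> as their image.\<close>
lemma tangent_vector_exists:
  assumes "c \<in> B" "p \<in> fst c" obtains v where "v \<in> tangent_space B p" "v c = y"
proof -
  define v where
    "v d = (if d \<in> B \<and> p \<in> fst d then frechet_derivative (transition c d) (at (snd c p)) y else 0)" for d
  have vc: "v c = y" using assms by (simp add: v_def transition_self)
  have "v e = frechet_derivative (transition d e) (at (snd d p)) (v d)"
    if "d \<in> B" "e \<in> B" "p \<in> fst d \<inter> fst e" for d e
    unfolding v_def using that transition_cocycle[OF assms(1) that(1,2) assms(2)] by auto
  moreover have "v d = 0" if "\<not> (d \<in> B \<and> p \<in> fst d)" for d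
    using that by (auto simp: v_def)
  ultimately have "v \<in> tangent_space B p"
    unfolding tangent_space_def by blast
  then show thesis using vc by (rule that)
qed

lemma tangent_vector_nonzero:
  assumes "v \<in> tangent_space B p" "c \<in> B" "p \<in> fst c"
  shows "v \<noteq> (\<lambda>_. 0) \<longleftrightarrow> v c \<noteq> 0"
proof -
  have "v d = 0" if "v c = 0" for d
  proof (cases "d \<in> B \<and> p \<in> fst d")
    case True
    then have "v d = frechet_derivative (transition c d) (at (snd c p)) (v c)"
      using assms unfolding tangent_space_def by blast
    then show ?thesis
      using that True assms linear_0[OF linear_frechet_derivative[OF transition_differentiable[of c d p]]]
      by simp
  next
    case False
    then show ?thesis using assms(1) unfolding tangent_space_def by blast
  qed
  then show ?thesis by auto
qed

end

locale surface =
  fixes M :: "'m topology" and A :: "('m, real^2) chart set"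
  assumes manifold: "smooth_manifold M A"
begin

sublocale base: smooth_atlas A
  by (rule smooth_manifold_atlas[OF manifold])

lemma smooth_transition:
  "c \<in> A \<Longrightarrow> d \<in> A \<Longrightarrow> smooth_on (snd c ` (fst c \<inter> fst d)) (transition c d)"
  using manifold by (auto simp: smooth_manifold_def)

lemma slit_chart_domain:
  "c \<in> A \<Longrightarrow> (p, v) \<in> fst (slit_chart A c) \<longleftrightarrow> p \<in> fst c \<and> v \<in> tangent_space A p \<and> v c \<noteq> 0"
  using base.tangent_vector_nonzero[of v p c]
  by (auto simp: slit_chart_def slit_bundle_def tangent_bundle_def carrier_of_def)

lemma slit_chart_map: "snd (slit_chart A c) (p, v) = (snd c p, v c)"
  by (simp add: slit_chart_def)

lemma slit_overlap_image:
  assumes "c \<in> A" "d \<in> A"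
  shows "snd (slit_chart A c) ` (fst (slit_chart A c) \<inter> fst (slit_chart A d))
    = (snd c ` (fst c \<inter> fst d)) \<times> (- {0})"
proof (intro equalityI subsetI)
  fix z assume "z \<in> snd (slit_chart A c) ` (fst (slit_chart A c) \<inter> fst (slit_chart A d))"
  then obtain p v where "(p, v) \<in> fst (slit_chart A c)" "(p, v) \<in> fst (slit_chart A d)"
    and "z = snd (slit_chart A c) (p, v)" by auto
  then show "z \<in> (snd c ` (fst c \<inter> fst d)) \<times> (- {0})"
    using assms by (simp add: slit_chart_domain slit_chart_map)
next
  fix z :: "(real^2) \<times> (real^2)" assume "z \<in> (snd c ` (fst c \<inter> fst d)) \<times> (- {0})"
  then obtain p y where p: "p \<in> fst c" "p \<in> fst d" "y \<noteq> 0" and z: "z = (snd c p, y)" by auto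
  obtain v where v: "v \<in> tangent_space A p" "v c = y"
    by (rule base.tangent_vector_exists[OF assms(1) p(1)])
  have "v d \<noteq> 0"
    using base.tangent_vector_nonzero[OF v(1)] assms p v(2) by blast
  then have "(p, v) \<in> fst (slit_chart A c) \<inter> fst (slit_chart A d)"
    using assms p v by (simp add: slit_chart_domain)
  moreover have "z = snd (slit_chart A c) (p, v)" using z v by (simp add: slit_chart_map)
  ultimately show "z \<in> snd (slit_chart A c) ` (fst (slit_chart A c) \<inter> fst (slit_chart A d))"
    by blast
qed

lemma slit_chart_inj:
  assumes c: "c \<in> A" shows "inj_on (snd (slit_chart A c)) (fst (slit_chart A c))"
proof (rule inj_onI)
  fix u w assume uw: "u \<in> fst (slit_chart A c)" "w \<in> fst (slit_chart A c)"
    "snd (slit_chart A c) u = snd (slit_chart A c) w"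
  obtain p v q v' where eq: "u = (p, v)" "w = (q, v')" by (metis surj_pair)
  have mem: "p \<in> fst c" "q \<in> fst c" "v \<in> tangent_space A p" "v' \<in> tangent_space A q"
    using uw c by (simp_all add: eq slit_chart_domain)
  have img: "snd c p = snd c q" "v c = v' c"
    using uw(3) by (simp_all add: eq slit_chart_map)
  have "p = q" by (rule inj_onD[OF base.chart_inj[OF c] img(1) mem(1,2)])
  moreover have "v = v'"
    using mem(2-4) \<open>p = q\<close> c img(2) tangent_space_eqI by metis
  ultimately show "u = w" by (simp add: eq)
qed

text \<open>The induced coordinate change is \<open>(x, y) \<mapsto> (\<tau> x, D\<tau>\<^sub>x y)\<close>, so a second derivative of \<open>\<tau>\<close> appears.\<close>
lemma slit_transition:
  assumes "c \<in> A" "d \<in> A" "u \<in> fst (slit_chart A c)" "u \<in> fst (slit_chart A d)"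
  shows "(transition (slit_chart A c) (slit_chart A d) has_derivative
    (\<lambda>w. (frechet_derivative (transition c d) (at (snd c (fst u))) (fst w),
      second_derivative (transition c d) (snd c (fst u)) (snd u c) (fst w)
      + frechet_derivative (transition c d) (at (snd c (fst u))) (snd w))))
    (at (snd (slit_chart A c) u))"
proof -
  let ?U = "snd c ` (fst c \<inter> fst d)" and ?t = "transition c d"
  obtain p v where u: "u = (p, v)" by fastforce
  have p: "p \<in> fst c" "p \<in> fst d" using assms u by (auto simp: slit_chart_domain)
  have z: "snd c p \<in> ?U" using p by blast
  have "((\<lambda>z. (?t (fst z), frechet_derivative ?t (at (fst z)) (snd z))) has_derivative
    (\<lambda>w. (frechet_derivative ?t (at (snd c p)) (fst w),
      second_derivative ?t (snd c p) (v c) (fst w) + frechet_derivative ?t (at (snd c p)) (snd w))))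
    (at (snd c p, v c))"
  proof (rule has_derivative_Pair)
    show "((\<lambda>z. ?t (fst z)) has_derivative (\<lambda>w. frechet_derivative ?t (at (snd c p)) (fst w)))
        (at (snd c p, v c))"
      using base.transition_has_derivative[OF assms(1,2) p]
      by (intro has_derivative_compose[where g = ?t, OF has_derivative_fst[OF has_derivative_ident]]) simp
    show "((\<lambda>z. frechet_derivative ?t (at (fst z)) (snd z)) has_derivative (\<lambda>w.
        second_derivative ?t (snd c p) (v c) (fst w) + frechet_derivative ?t (at (snd c p)) (snd w)))
        (at (snd c p, v c))"
      using has_derivative_frechet_along[OF base.open_overlap[OF assms(1,2)] smooth_transition[OF assms(1,2)],
          of fst "(snd c p, v c)" fst snd snd] z
      by (simp add: has_derivative_fst has_derivative_snd)
  qed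
  moreover have "open (?U \<times> (- {0 :: real^2}))"
    by (intro open_Times base.open_overlap assms) auto
  ultimately have "(transition (slit_chart A c) (slit_chart A d) has_derivative
    (\<lambda>w. (frechet_derivative ?t (at (snd c p)) (fst w),
      second_derivative ?t (snd c p) (v c) (fst w) + frechet_derivative ?t (at (snd c p)) (snd w))))
    (at (snd c p, v c))"
  proof (rule has_derivative_transform_within_open)
    show "(snd c p, v c) \<in> ?U \<times> (- {0})"
      using assms(1,3) z by (simp add: u slit_chart_domain)
    fix z :: "(real^2) \<times> (real^2)" assume "z \<in> ?U \<times> (- {0})"
    then obtain q w where q: "(q, w) \<in> fst (slit_chart A c) \<inter> fst (slit_chart A d)"
      and zq: "z = snd (slit_chart A c) (q, w)"
      unfolding slit_overlap_image[OF assms(1,2), symmetric] by auto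
    have mem: "q \<in> fst c" "q \<in> fst d" "w \<in> tangent_space A q"
      using q assms by (auto simp: slit_chart_domain)
    have "transition (slit_chart A c) (slit_chart A d) z = snd (slit_chart A d) (q, w)"
      unfolding transition_def zq chart_inv_def o_def
      using the_inv_into_f_f[OF slit_chart_inj[OF assms(1)], of "(q, w)"] q by simp
    moreover have "w d = frechet_derivative ?t (at (snd c q)) (w c)"
      using mem assms(1,2) unfolding tangent_space_def by blast
    ultimately show "(?t (fst z), frechet_derivative ?t (at (fst z)) (snd z))
        = transition (slit_chart A c) (slit_chart A d) z"
      using mem assms(1) by (simp add: zq slit_chart_map base.transition_chart)
  qed
  then show ?thesis by (simp add: u slit_chart_map)
qed

sublocale smooth_atlas "slit_atlas A"
proof
  fix k assume "k \<in> slit_atlas A"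
  then obtain c where c: "c \<in> A" "k = slit_chart A c" by (auto simp: slit_atlas_def)
  show "inj_on (snd k) (fst k)" using c slit_chart_inj by simp
  have "snd k ` (fst k \<inter> fst k) = snd c ` (fst c \<inter> fst c) \<times> (- {0})"
    unfolding c(2) by (rule slit_overlap_image[OF c(1) c(1)])
  moreover have "open (\<dots>)" by (intro open_Times base.open_overlap c) auto
  ultimately show "open (snd k ` fst k)" by simp
next
  fix k l assume "k \<in> slit_atlas A" "l \<in> slit_atlas A"
  then obtain c d where cd: "c \<in> A" "k = slit_chart A c" "d \<in> A" "l = slit_chart A d"
    by (auto simp: slit_atlas_def)
  have "open (snd c ` (fst c \<inter> fst d) \<times> (- {0 :: real^2}))"
    by (intro open_Times base.open_overlap cd) auto
  then show "open (snd k ` (fst k \<inter> fst l))" using slit_overlap_image[OF cd(1,3)] cd by simp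
  show "transition k l differentiable (at (snd k u))" if "u \<in> fst k \<inter> fst l" for u
    using slit_transition[OF cd(1,3), of u] that cd unfolding differentiable_def by auto
qed

lemma carrier_slit_atlas: "carrier_of (slit_atlas A) = slit_bundle A"
  by (fastforce simp: carrier_of_def slit_atlas_def slit_chart_def slit_bundle_def tangent_bundle_def)

text \<open>The derivative of an induced coordinate change is block triangular with equal diagonal blocks,
  hence commutes with \<open>(a, b) \<mapsto> (0, a)\<close>.\<close>
lemma almost_tangent_tangent:
  assumes X: "X u \<in> tangent_space (slit_atlas A) u"
  shows "almost_tangent X u \<in> tangent_space (slit_atlas A) u"
  unfolding tangent_space_def
proof (intro CollectI conjI ballI allI impI)
  fix k l assume kl: "k \<in> slit_atlas A" "l \<in> slit_atlas A" "u \<in> fst k \<inter> fst l"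
  then obtain c d where cd: "c \<in> A" "k = slit_chart A c" "d \<in> A" "l = slit_chart A d"
    by (auto simp: slit_atlas_def)
  define D where "D = frechet_derivative (transition k l) (at (snd k u))"
  let ?T = "frechet_derivative (transition c d) (at (snd c (fst u)))"
  have D: "D w = (?T (fst w),
      second_derivative (transition c d) (snd c (fst u)) (snd u c) (fst w) + ?T (snd w))" for w
    unfolding D_def using frechet_eq[OF slit_transition[OF cd(1,3), of u]] kl cd by simp
  have lin: "linear D"
    unfolding D_def by (rule linear_frechet_derivative[OF transition_differentiable[OF kl]])
  have "X u l = D (X u k)"
    unfolding D_def using X kl unfolding tangent_space_def by blast
  then have "fst (X u l) = ?T (fst (X u k))" by (simp add: D)
  moreover have "?T 0 = 0" "second_derivative (transition c d) (snd c (fst u)) (snd u c) 0 = 0"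
    using linear_0[OF lin] D[of 0] by (auto simp: zero_prod_def)
  ultimately have "almost_tangent X u l = D (almost_tangent X u k)"
    by (simp add: almost_tangent_def D)
  then show "almost_tangent X u l = frechet_derivative (transition k l) (at (snd k u)) (almost_tangent X u k)"
    by (simp add: D_def)
next
  fix k assume "\<not> (k \<in> slit_atlas A \<and> u \<in> fst k)"
  then have "X u k = 0" using X unfolding tangent_space_def by blast
  then show "almost_tangent X u k = 0" by (simp add: almost_tangent_def zero_prod_def)
qed

end

section \<open>The Berwald connection of a spray in induced coordinates\<close>

locale surface_spray = surface M A
  for M :: "'m topology" and A :: "('m, real^2) chart set" +
  fixes S :: "'m svfield"
  assumes spray: "spray A S"
begin

notation same (infix "\<simeq>" 50)

abbreviation "J \<equiv> almost_tangent"
abbreviation "C \<equiv> liouville A"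
abbreviation "h \<equiv> horizontal_proj A S"
abbreviation "v \<equiv> vertical_proj A S"
abbreviation "\<theta> \<equiv> theta A S"
abbreviation "D \<equiv> berwald_connection A S"

definition at_chart where "at_chart u k \<longleftrightarrow> k \<in> slit_atlas A \<and> u \<in> fst k"

definition field_deriv where
  "field_deriv k u X w = frechet_derivative (vf_rep k X) (at (snd k u)) w"

text \<open>With \<open>S = (y, -2G)\<close> this is \<open>- G\<^sup>i\<^sub>j a\<^sup>j\<close>: the horizontal lift of \<open>a\<close> is \<open>(a, nonlinear k u a)\<close>.\<close>
definition nonlinear where
  "nonlinear k u a = (1/2) *\<^sub>R snd (field_deriv k u S (0, a))"

text \<open>The vertical derivative of \<open>nonlinear\<close>, \<open>- G\<^sup>i\<^sub>j\<^sub>l \<xi>\<^sup>j a\<^sup>l\<close>, which is minus the Christoffel term of the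
  Berwald connection.\<close>
definition berwald_coeff where
  "berwald_coeff k u a \<xi> = (1/2) *\<^sub>R snd (second_derivative (vf_rep k S) (snd k u) (0, \<xi>) (0, a))"

lemma J_at: "J X u k = (0, fst (X u k))"
  by (simp add: almost_tangent_def)

lemma at_chartD: "at_chart u k \<Longrightarrow> k \<in> slit_atlas A" "at_chart u k \<Longrightarrow> u \<in> fst k"
  by (simp_all add: at_chart_def)

lemma smooth_S: "smooth_field S"
  using spray by (simp add: spray_def vector_field_def smooth_field_def)

lemma fst_S: "at_chart u k \<Longrightarrow> fst (S u k) = snd (snd k u)"
proof -
  assume u: "at_chart u k"
  then have "u \<in> slit_bundle A" using in_carrier[OF at_chartD] carrier_slit_atlas by blast
  then have "J S u k = C u k" using spray by (simp add: spray_def eq_on_def)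
  then show ?thesis using u by (simp add: J_at liouville_def at_chart_def)
qed

lemma fst_field_derivI:
  assumes "smooth_field X" "at_chart u k"
    and "\<And>w. at_chart w k \<Longrightarrow> fst (X w k) = g (snd k w)"
    and "(g has_derivative g') (at (snd k u))"
  shows "fst (field_deriv k u X w) = g' w"
proof -
  note k = at_chartD[OF assms(2)]
  have "((\<lambda>z. fst (vf_rep k X z)) has_derivative (\<lambda>w. fst (field_deriv k u X w))) (at (snd k u))"
    unfolding field_deriv_def by (intro has_derivative_fst field_differentiable assms k)
  moreover have "((\<lambda>z. fst (vf_rep k X z)) has_derivative g') (at (snd k u))"
    by (rule has_derivative_transform_within_open[OF assms(4) open_image[OF k(1)]])
      (use k assms(3) in \<open>auto simp: vf_rep_at at_chart_def\<close>)
  ultimately show ?thesis by (metis has_derivative_unique)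
qed

lemma snd_field_derivI:
  assumes "smooth_field X" "at_chart u k"
    and "\<And>w. at_chart w k \<Longrightarrow> snd (X w k) = g (snd k w)"
    and "(g has_derivative g') (at (snd k u))"
  shows "snd (field_deriv k u X w) = g' w"
proof -
  note k = at_chartD[OF assms(2)]
  have "((\<lambda>z. snd (vf_rep k X z)) has_derivative (\<lambda>w. snd (field_deriv k u X w))) (at (snd k u))"
    unfolding field_deriv_def by (intro has_derivative_snd field_differentiable assms k)
  moreover have "((\<lambda>z. snd (vf_rep k X z)) has_derivative g') (at (snd k u))"
    by (rule has_derivative_transform_within_open[OF assms(4) open_image[OF k(1)]])
      (use k assms(3) in \<open>auto simp: vf_rep_at at_chart_def\<close>)
  ultimately show ?thesis by (metis has_derivative_unique)
qed

lemma fst_field_deriv_cong: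
  assumes "smooth_field X" "smooth_field Y" "at_chart u k"
    and "\<And>w. at_chart w k \<Longrightarrow> fst (X w k) = fst (Y w k)"
  shows "fst (field_deriv k u X w) = fst (field_deriv k u Y w)"
proof (rule fst_field_derivI[OF assms(1,3)])
  note k = at_chartD[OF assms(3)]
  show "((\<lambda>z. fst (vf_rep k Y z)) has_derivative (\<lambda>w. fst (field_deriv k u Y w))) (at (snd k u))"
    unfolding field_deriv_def by (intro has_derivative_fst field_differentiable assms k)
qed (use assms(4) in \<open>simp add: vf_rep_at at_chart_def\<close>)

lemma field_deriv_linear: "smooth_field X \<Longrightarrow> at_chart u k \<Longrightarrow> linear (field_deriv k u X)"
  unfolding field_deriv_def by (intro field_derivative_linear) (auto simp: at_chart_def)

lemma fst_field_deriv_S: "at_chart u k \<Longrightarrow> fst (field_deriv k u S w) = snd w"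
  by (rule fst_field_derivI[OF smooth_S _ _ has_derivative_snd[OF has_derivative_ident]]) (auto simp: fst_S)

lemma lie_at_chart:
  "at_chart u k \<Longrightarrow> lie X Y u k = field_deriv k u Y (X u k) - field_deriv k u X (Y u k)"
  by (simp add: lie_at at_chart_def field_deriv_def)

lemma smooth_J: "smooth_field X \<Longrightarrow> smooth_field (J X)"
  by (rule smooth_fieldI[where f = "\<lambda>k z. (0, fst (vf_rep k X z))"])
    (simp_all add: J_at vf_rep_at smooth_on_intros smooth_fieldD open_image)

lemma field_deriv_J:
  assumes "smooth_field X" "at_chart u k"
  shows "field_deriv k u (J X) w = (0, fst (field_deriv k u X w))"
proof -
  note k = at_chartD[OF assms(2)]
  have "fst (field_deriv k u (J X) w) = 0"
    by (rule fst_field_derivI[OF smooth_J[OF assms(1)] assms(2) _ has_derivative_const])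
      (simp add: J_at)
  moreover have "snd (field_deriv k u (J X) w) = fst (field_deriv k u X w)"
  proof (rule snd_field_derivI[OF smooth_J[OF assms(1)] assms(2)])
    show "((\<lambda>z. fst (vf_rep k X z)) has_derivative (\<lambda>w. fst (field_deriv k u X w))) (at (snd k u))"
      unfolding field_deriv_def by (intro has_derivative_fst field_differentiable assms k)
  qed (simp add: J_at vf_rep_at at_chart_def)
  ultimately show ?thesis by (simp add: prod_eq_iff)
qed

lemma nonlinear_linear:
  assumes "at_chart u k" shows "linear (nonlinear k u)"
proof -
  note lin = field_deriv_linear[OF smooth_S assms]
  have "(0 :: real^2, a + b) = (0, a) + (0, b)" "(0 :: real^2, r *\<^sub>R a) = r *\<^sub>R (0, a)" for r and a b :: "real^2"
    by simp_all
  then show ?thesis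
    unfolding nonlinear_def
    by (intro linearI) (simp_all only: linear_add[OF lin] linear_cmul[OF lin],
      simp_all add: scaleR_right_distrib)
qed

text \<open>The derivatives of \<open>X\<close> along \<open>S\<close> in \<open>[J X, S]\<close> and \<open>J [X, S]\<close> are equal, so \<open>[J, S]\<close> acts pointwise.\<close>
lemma fn_bracket_at:
  assumes "smooth_field X" "at_chart u k"
  shows "fn_bracket_form_field (slit_atlas A) J S X u k
    = (fst (X u k), 2 *\<^sub>R nonlinear k u (fst (X u k)) - snd (X u k))"
proof -
  have "lie (J X) S u k = (fst (X u k), snd (field_deriv k u S (0, fst (X u k))) - fst (field_deriv k u X (S u k)))"
    using fst_field_deriv_S[OF assms(2)]
    by (simp add: lie_at_chart assms field_deriv_J prod_eq_iff J_at)
  moreover have "J (lie X S) u k = (0, snd (X u k) - fst (field_deriv k u X (S u k)))"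
    by (simp add: lie_at_chart assms J_at fst_field_deriv_S)
  ultimately show ?thesis
    by (simp add: fn_bracket_form_field_def nonlinear_def)
qed

lemma horizontal_proj_at:
  "smooth_field X \<Longrightarrow> at_chart u k \<Longrightarrow> h X u k = (fst (X u k), nonlinear k u (fst (X u k)))"
  by (simp add: horizontal_proj_def vf_scale_def fn_bracket_at prod_eq_iff algebra_simps)

lemma vertical_proj_at:
  "smooth_field X \<Longrightarrow> at_chart u k \<Longrightarrow> v X u k = (0, snd (X u k) - nonlinear k u (fst (X u k)))"
  by (simp add: vertical_proj_def vf_scale_def fn_bracket_at prod_eq_iff algebra_simps)

lemma smooth_h: "smooth_field X \<Longrightarrow> smooth_field (h X)"
  by (rule smooth_fieldI[where f = "\<lambda>k z. (fst (vf_rep k X z),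
        (1/2) *\<^sub>R snd (frechet_derivative (vf_rep k S) (at z) (0, fst (vf_rep k X z))))"])
    (simp_all add: horizontal_proj_at at_chart_def nonlinear_def field_deriv_def vf_rep_at
      smooth_on_intros smooth_fieldD smooth_S open_image)

lemma smooth_v: "smooth_field X \<Longrightarrow> smooth_field (v X)"
  by (rule smooth_field_cong[of "X - h X"])
    (simp_all add: same_def horizontal_proj_at vertical_proj_at at_chart_def prod_eq_iff smooth_diff smooth_h)

text \<open>The \<open>x\<close>-components of \<open>[S, h X]\<close> and \<open>[S, X]\<close> differ only through the vertical parts of \<open>h X\<close> and
  \<open>X\<close>, so \<open>\<theta>\<close> takes a vertical vector to the horizontal vector with the same components.\<close>
lemma theta_at:
  assumes X: "smooth_field X" and u: "at_chart u k"
  shows "\<theta> X u k = (snd (v X u k), nonlinear k u (snd (v X u k)))"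
proof -
  let ?W = "lie S (h X) - h (lie S X)"
  have W: "smooth_field ?W" by (intro smooth_diff smooth_lie smooth_h smooth_S X)
  have "fst (field_deriv k u (h X) w) = fst (field_deriv k u X w)" for w
    by (rule fst_field_deriv_cong[OF smooth_h[OF X] X u]) (simp add: horizontal_proj_at X)
  then have "fst (?W u k) = snd (v X u k)"
    using u by (simp add: lie_at_chart horizontal_proj_at vertical_proj_at smooth_lie smooth_S X
        fst_field_deriv_S)
  then show ?thesis
    by (simp add: theta_def fn_bracket_field_form_def horizontal_proj_at[OF W u])
qed

lemma smooth_theta: "smooth_field X \<Longrightarrow> smooth_field (\<theta> X)"
  unfolding theta_def fn_bracket_field_form_def
  by (intro smooth_h smooth_diff smooth_lie smooth_S)

lemma field_deriv_h:
  assumes X: "smooth_field X" and u: "at_chart u k"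
  shows "field_deriv k u (h X) w = (fst (field_deriv k u X w),
    (1/2) *\<^sub>R snd (second_derivative (vf_rep k S) (snd k u) (0, fst (X u k)) w)
    + nonlinear k u (fst (field_deriv k u X w)))"
proof -
  note k = at_chartD[OF u]
  have z: "snd k u \<in> snd k ` fst k" using k by blast
  have fX: "((\<lambda>z. fst (vf_rep k X z)) has_derivative (\<lambda>w. fst (field_deriv k u X w))) (at (snd k u))"
    unfolding field_deriv_def by (intro has_derivative_fst field_differentiable X k)
  have "fst (field_deriv k u (h X) w) = fst (field_deriv k u X w)"
    by (rule fst_field_deriv_cong[OF smooth_h[OF X] X u]) (simp add: horizontal_proj_at X)
  moreover have "snd (field_deriv k u (h X) w) =
      (1/2) *\<^sub>R snd (second_derivative (vf_rep k S) (snd k u) (0, fst (vf_rep k X (snd k u))) w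
      + frechet_derivative (vf_rep k S) (at (snd k u)) (0, fst (field_deriv k u X w)))"
  proof (rule snd_field_derivI[OF smooth_h[OF X] u])
    show "((\<lambda>z. (1/2) *\<^sub>R snd (frechet_derivative (vf_rep k S) (at z) (0, fst (vf_rep k X z))))
      has_derivative (\<lambda>w. (1/2) *\<^sub>R snd (second_derivative (vf_rep k S) (snd k u) (0, fst (vf_rep k X (snd k u))) w
      + frechet_derivative (vf_rep k S) (at (snd k u)) (0, fst (field_deriv k u X w))))) (at (snd k u))"
      by (intro has_derivative_scaleR_right has_derivative_snd
          has_derivative_frechet_along[OF open_image[OF k(1)] smooth_fieldD[OF smooth_S k(1)] z
            has_derivative_ident] has_derivative_Pair has_derivative_const fX)
  qed (simp add: horizontal_proj_at[OF X] at_chart_def vf_rep_at nonlinear_def field_deriv_def)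
  ultimately show ?thesis
    using k by (simp add: prod_eq_iff vf_rep_at nonlinear_def field_deriv_def scaleR_right_distrib)
qed

lemma berwald_coeff_linear:
  assumes "at_chart u k"
  shows "linear (berwald_coeff k u a)" "linear (\<lambda>a. berwald_coeff k u a \<xi>)"
proof -
  note k = at_chartD[OF assms]
  have z: "snd k u \<in> snd k ` fst k" using k by blast
  note sm = smooth_fieldD[OF smooth_S k(1)]
  let ?s = "second_derivative (vf_rep k S) (snd k u)"
  have l2: "linear (?s w)" for w
    unfolding second_derivative_def by (rule smooth_on_linear[OF smooth_on_frechet_fixed[OF sm] z])
  have l1: "linear (\<lambda>w. ?s w x)" for x
    unfolding second_derivative_symmetric[OF open_image[OF k(1)] sm z, of _ x] by (rule l2)
  have e: "(0 :: real^2, a + b) = (0, a) + (0, b)" "(0 :: real^2, r *\<^sub>R a) = r *\<^sub>R (0, a)" for r and a b :: "real^2"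
    by simp_all
  show "linear (berwald_coeff k u a)"
    unfolding berwald_coeff_def
    by (intro linearI) (simp_all only: e linear_add[OF l1] linear_cmul[OF l1],
      simp_all add: scaleR_right_distrib)
  show "linear (\<lambda>a. berwald_coeff k u a \<xi>)"
    unfolding berwald_coeff_def
    by (intro linearI) (simp_all only: e linear_add[OF l2] linear_cmul[OF l2],
      simp_all add: scaleR_right_distrib)
qed

text \<open>The \<open>x\<close>-components of \<open>D X Y\<close>. They depend on \<open>X\<close> only through the vector \<open>x\<close> at the point, and on \<open>Y\<close>
  only through its \<open>x\<close>-components; applied to \<open>\<theta> Y\<close>, the same operator gives the vertical part of \<open>D X Y\<close>.\<close>
definition covariant where
  "covariant k u x Y = fst (field_deriv k u Y x) - berwald_coeff k u (fst (Y u k)) (fst x)"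

text \<open>The derivative of \<open>X\<close> contributes a horizontal vector to the bracket, which is removed by the
  projection; what is left of the derivative of \<open>h X\<close> is the derivative of the nonlinear coefficients.\<close>
lemma lie_h_J:
  assumes X: "smooth_field X" and Z: "smooth_field Z" and u: "at_chart u k"
  shows "snd (v (lie (h X) (J Z)) u k) = covariant k u (h X u k) Z"
proof -
  have "lie (h X) (J Z) u k = (- fst (field_deriv k u X (0, fst (Z u k))),
      fst (field_deriv k u Z (h X u k)) - (berwald_coeff k u (fst (Z u k)) (fst (X u k))
        + nonlinear k u (fst (field_deriv k u X (0, fst (Z u k))))))"
    by (simp add: lie_at_chart u field_deriv_J Z field_deriv_h X berwald_coeff_def J_at)
  then show ?thesis
    by (simp add: vertical_proj_at[OF smooth_lie[OF smooth_h[OF X] smooth_J[OF Z]] u] covariant_def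
        horizontal_proj_at[OF X u] linear_neg[OF nonlinear_linear[OF u]])
qed

lemma fst_lie_v:
  assumes X: "smooth_field X" and Z: "smooth_field Z" and u: "at_chart u k"
  shows "fst (lie (v X) Z u k) = covariant k u (v X u k) Z"
proof -
  have "fst (field_deriv k u (v X) w) = 0" for w
    by (rule fst_field_derivI[OF smooth_v[OF X] u _ has_derivative_const])
      (simp add: vertical_proj_at X)
  then show ?thesis
    by (simp add: lie_at_chart u covariant_def vertical_proj_at X linear_0[OF berwald_coeff_linear(1)[OF u]])
qed

lemma covariant_add_left:
  assumes "smooth_field Y" "at_chart u k"
  shows "covariant k u (x + x') Y = covariant k u x Y + covariant k u x' Y"
  using assms by (simp add: covariant_def linear_add[OF field_deriv_linear]
      linear_add[OF berwald_coeff_linear(1)])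

lemma covariant_scale_left:
  assumes "smooth_field Y" "at_chart u k"
  shows "covariant k u (r *\<^sub>R x) Y = r *\<^sub>R covariant k u x Y"
  using assms by (simp add: covariant_def linear_cmul[OF field_deriv_linear]
      linear_cmul[OF berwald_coeff_linear(1)] algebra_simps)

lemma covariant_cong:
  assumes "smooth_field Y" "smooth_field Z" "at_chart u k"
    and "\<And>w. at_chart w k \<Longrightarrow> fst (Y w k) = fst (Z w k)"
  shows "covariant k u x Y = covariant k u x Z"
  unfolding covariant_def using fst_field_deriv_cong[OF assms] assms(3,4) by simp

lemma covariant_scale:
  assumes f: "smooth_function (slit_atlas A) f" and Y: "smooth_field Y" and u: "at_chart u k"
  shows "covariant k u (X u k) (f \<odot> Y) =
    chart_deriv k X f u *\<^sub>R fst (Y u k) + f u *\<^sub>R covariant k u (X u k) Y"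
proof -
  have "(f \<odot> Y) u k = f u *\<^sub>R Y u k" by (simp add: vf_scale_def)
  then show ?thesis
    using derivative_scale[OF f Y at_chartD[OF u]]
    by (simp add: covariant_def field_deriv_def chart_deriv_def algebra_simps
        linear_cmul[OF berwald_coeff_linear(2)[OF u]])
qed

text \<open>The summands of \<open>D X Y\<close> pair up: two of them are the covariant derivatives of \<open>Y\<close> along \<open>h X\<close> and
  \<open>v X\<close>, the other two those of \<open>\<theta> Y\<close>.\<close>
lemma connection_at:
  assumes X: "smooth_field X" and Y: "smooth_field Y" and u: "at_chart u k"
  shows "D X Y u k = (covariant k u (X u k) Y,
    nonlinear k u (covariant k u (X u k) Y) + covariant k u (X u k) (\<theta> Y))"
proof -
  note sm = smooth_h smooth_v smooth_J smooth_theta smooth_lie X Y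
  have split: "X u k = h X u k + v X u k"
    by (simp add: horizontal_proj_at vertical_proj_at X u prod_eq_iff)
  have "v Y \<simeq> J (\<theta> Y)"
    by (simp add: same_def vertical_proj_at Y J_at theta_at at_chart_def)
  then have 1: "v (lie (h X) (v Y)) u k = (0, covariant k u (h X u k) (\<theta> Y))"
    using lie_cong[of "h X" "h X" "v Y" "J (\<theta> Y)"] lie_h_J[OF X smooth_theta[OF Y] u]
    by (simp add: same_def vertical_proj_at[OF smooth_lie[OF smooth_h[OF X] smooth_J[OF smooth_theta[OF Y]]] u])
  have 2: "h (lie (v X) (h Y)) u k = (covariant k u (v X u k) Y, nonlinear k u (covariant k u (v X u k) Y))"
  proof -
    have "covariant k u x (h Y) = covariant k u x Y" for x
      by (rule covariant_cong) (simp_all add: horizontal_proj_at Y u smooth_h)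
    then show ?thesis
      by (simp add: horizontal_proj_at smooth_lie smooth_v smooth_h X Y u fst_lie_v)
  qed
  have 3: "J (lie (v X) (\<theta> Y)) u k = (0, covariant k u (v X u k) (\<theta> Y))"
    by (simp add: J_at fst_lie_v X smooth_theta Y u)
  have 4: "\<theta> (lie (h X) (J Y)) u k = (covariant k u (h X u k) Y, nonlinear k u (covariant k u (h X u k) Y))"
    by (simp add: theta_at smooth_lie smooth_h smooth_J X Y u lie_h_J)
  show ?thesis
    unfolding berwald_connection_def Let_def plus_fun_apply 1 2 3 4 split
    by (simp add: covariant_add_left Y u smooth_theta linear_add[OF nonlinear_linear[OF u]])
qed

lemma smooth_connection: "smooth_field X \<Longrightarrow> smooth_field Y \<Longrightarrow> smooth_field (D X Y)"
  unfolding berwald_connection_def Let_def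
  by (intro smooth_add smooth_h smooth_v smooth_J smooth_theta smooth_lie)

lemma h_cong: "X \<simeq> Y \<Longrightarrow> smooth_field X \<Longrightarrow> h X \<simeq> h Y"
  using smooth_field_cong[of X Y] by (simp add: same_def horizontal_proj_at at_chart_def)

lemma v_cong: "X \<simeq> Y \<Longrightarrow> smooth_field X \<Longrightarrow> v X \<simeq> v Y"
  using smooth_field_cong[of X Y] by (simp add: same_def vertical_proj_at at_chart_def)

lemma theta_cong: "X \<simeq> Y \<Longrightarrow> smooth_field X \<Longrightarrow> \<theta> X \<simeq> \<theta> Y"
  using smooth_field_cong[of X Y] by (simp add: same_def theta_at vertical_proj_at at_chart_def)

lemma J_cong: "X \<simeq> Y \<Longrightarrow> J X \<simeq> J Y"
  by (simp add: same_def J_at)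

lemma connection_cong:
  assumes "X \<simeq> X'" "smooth_field X" "Y \<simeq> Y'" "smooth_field Y"
  shows "D X Y = D X' Y'"
proof -
  note c = h_cong[OF assms(1,2)] v_cong[OF assms(1,2)] v_cong[OF assms(3,4)] h_cong[OF assms(3,4)]
    theta_cong[OF assms(3,4)] J_cong[OF assms(3)]
  show ?thesis
    unfolding berwald_connection_def Let_def lie_cong[OF c(1,3)] lie_cong[OF c(2,4)]
      lie_cong[OF c(2,5)] lie_cong[OF c(1,6)] ..
qed

text \<open>At a pair of a point and a chart not containing it, brackets vanish by definition. So do, in
  consequence, the connection and its curvature, as equality of fields on the slit bundle demands.\<close>
lemma off_chart:
  assumes "\<not> at_chart u k"
  shows "h X u k = (1/2) *\<^sub>R X u k" "v X u k = (1/2) *\<^sub>R X u k"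
    "X u k = 0 \<Longrightarrow> J X u k = 0" "X u k = 0 \<Longrightarrow> \<theta> X u k = 0"
proof -
  have lie0: "lie X Y u k = 0" for X Y
    using assms by (intro lie_off) (simp add: at_chart_def)
  have fn: "fn_bracket_form_field (slit_atlas A) J S X u k = 0" for X
    by (simp add: fn_bracket_form_field_def lie0 J_at zero_prod_def)
  show h: "h X u k = (1/2) *\<^sub>R X u k" for X by (simp add: horizontal_proj_def vf_scale_def fn)
  show "v X u k = (1/2) *\<^sub>R X u k" by (simp add: vertical_proj_def vf_scale_def fn)
  show "J X u k = 0" if "X u k = 0" using that by (simp add: J_at zero_prod_def)
  show "\<theta> X u k = 0" by (simp add: theta_def fn_bracket_field_form_def h lie0)
qed

lemma connection_off_chart:
  assumes "\<not> at_chart u k" shows "D X Y u k = 0"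
proof -
  have "lie X Y u k = 0" for X Y
    using assms by (intro lie_off) (simp add: at_chart_def)
  then show ?thesis
    using assms by (simp add: berwald_connection_def Let_def off_chart)
qed

lemma connection_add_left:
  assumes "smooth_field X" "smooth_field X'" "smooth_field Y"
  shows "D (X + X') Y = D X Y + D X' Y"
proof (rule ext, rule ext)
  fix u k
  show "D (X + X') Y u k = (D X Y + D X' Y) u k"
  proof (cases "at_chart u k")
    case True
    then show ?thesis
      using assms by (simp add: connection_at smooth_add covariant_add_left smooth_theta
          linear_add[OF nonlinear_linear])
  qed (simp add: connection_off_chart)
qed

lemma connection_scale_left:
  assumes "smooth_function (slit_atlas A) f" "smooth_field X" "smooth_field Y"
  shows "D (f \<odot> X) Y = f \<odot> D X Y"
proof (rule ext, rule ext)
  fix u k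
  have "(f \<odot> X) u k = f u *\<^sub>R X u k" by (simp add: vf_scale_def)
  moreover have "(f \<odot> D X Y) u k = f u *\<^sub>R D X Y u k" by (simp add: vf_scale_def)
  ultimately show "D (f \<odot> X) Y u k = (f \<odot> D X Y) u k"
    using assms by (cases "at_chart u k") (simp_all add: connection_at smooth_scale covariant_scale_left
      smooth_theta linear_cmul[OF nonlinear_linear] connection_off_chart scaleR_right_distrib)
qed

lemma connection_uminus_left:
  assumes "smooth_field X" "smooth_field Y"
  shows "D (- X) Y = - D X Y"
proof (rule ext, rule ext)
  fix u k
  have "covariant k u (- x) Z = - covariant k u x Z" if "smooth_field Z" "at_chart u k" for x Z
    using covariant_scale_left[OF that, of "-1" x] by simp
  then show "D (- X) Y u k = (- D X Y) u k"
    using assms by (cases "at_chart u k") (simp_all add: connection_at smooth_uminus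
      smooth_theta linear_neg[OF nonlinear_linear] connection_off_chart)
qed

lemma connection_add_right:
  assumes X: "smooth_field X" and Y: "smooth_field Y" and Z: "smooth_field Z" and u: "at_chart u k"
  shows "D X (Y + Z) u k = D X Y u k + D X Z u k"
proof -
  have cov: "covariant k u x (Y + Z) = covariant k u x Y + covariant k u x Z"
    if "smooth_field Y" "smooth_field Z" for x Y Z
    using that u derivative_add[OF that at_chartD[OF u]]
    by (simp add: covariant_def field_deriv_def linear_add[OF berwald_coeff_linear(2)[OF u]])
  have "covariant k u x (\<theta> (Y + Z)) = covariant k u x (\<theta> Y + \<theta> Z)" for x
    by (rule covariant_cong)
      (simp_all add: theta_at vertical_proj_at smooth_add smooth_theta Y Z u linear_add[OF nonlinear_linear])
  then show ?thesis
    using assms by (simp add: connection_at smooth_add cov smooth_theta linear_add[OF nonlinear_linear])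
qed

lemma connection_scale_right:
  assumes X: "smooth_field X" and f: "smooth_function (slit_atlas A) f" and Y: "smooth_field Y"
    and u: "at_chart u k"
  shows "D X (f \<odot> Y) u k = chart_deriv k X f u *\<^sub>R Y u k + f u *\<^sub>R D X Y u k"
proof -
  have sc: "(f \<odot> Z) w k = f w *\<^sub>R Z w k" for Z w by (simp add: vf_scale_def)
  have "covariant k u (X u k) (\<theta> (f \<odot> Y)) = covariant k u (X u k) (f \<odot> \<theta> Y)"
    by (rule covariant_cong)
      (simp_all add: theta_at vertical_proj_at smooth_scale smooth_theta f Y u sc
        linear_cmul[OF nonlinear_linear] scaleR_right_diff_distrib)
  then show ?thesis
    using assms by (simp add: connection_at smooth_scale covariant_scale smooth_theta theta_at
        vertical_proj_at linear_add[OF nonlinear_linear] linear_cmul[OF nonlinear_linear]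
        prod_eq_iff algebra_simps)
qed

text \<open>\<open>J Y\<close> has no \<open>x\<close>-components, while \<open>\<theta> (J Y)\<close> has those of \<open>Y\<close>.\<close>
lemma connection_J:
  assumes X: "smooth_field X" and Y: "smooth_field Y" shows "D X (J Y) = J (D X Y)"
proof (rule ext, rule ext)
  fix u k
  show "D X (J Y) u k = J (D X Y) u k"
  proof (cases "at_chart u k")
    case True
    have "fst (field_deriv k u (J Y) (X u k)) = 0"
      using Y True by (simp add: field_deriv_J)
    then have "covariant k u (X u k) (J Y) = 0"
      by (simp add: covariant_def J_at linear_0[OF berwald_coeff_linear(2)[OF True]])
    moreover have "covariant k u (X u k) (\<theta> (J Y)) = covariant k u (X u k) Y"
      by (rule covariant_cong) (simp_all add: theta_at vertical_proj_at smooth_J smooth_theta Y True J_at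
        linear_0[OF nonlinear_linear])
    ultimately show ?thesis
      using True X Y by (simp add: connection_at smooth_J J_at linear_0[OF nonlinear_linear])
  qed (simp add: connection_off_chart J_at zero_prod_def)
qed

end

section \<open>Curvature of the Berwald connection\<close>

context surface_spray
begin

abbreviation "R \<equiv> berwald_curvature A S"

lemma connection_zero:
  assumes "smooth_field X" shows "D X 0 = 0" "D 0 X = 0"
proof -
  have "D X 0 u k = 0" for u k
    using connection_add_right[OF assms smooth_zero smooth_zero, of u k]
    by (cases "at_chart u k") (simp_all add: connection_off_chart)
  then show "D X 0 = 0" by (simp add: fun_eq_iff)
  show "D 0 X = 0"
    using connection_add_left[OF smooth_zero smooth_zero assms] by simp
qed

lemma connection_uminus_right:
  assumes "smooth_field X" "smooth_field Y" "at_chart u k"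
  shows "D X (- Y) u k = - D X Y u k"
proof -
  have "D X (Y + - Y) u k = D X Y u k + D X (- Y) u k"
    using assms by (intro connection_add_right smooth_uminus)
  then show ?thesis by (simp add: connection_zero assms eq_neg_iff_add_eq_0 add.commute)
qed

lemma connection_diff_right:
  assumes "smooth_field X" "smooth_field Y" "smooth_field Z" "at_chart u k"
  shows "D X (Y - Z) u k = D X Y u k - D X Z u k"
  using connection_add_right[OF assms(1,2) smooth_uminus[OF assms(3)] assms(4)]
    connection_uminus_right[OF assms(1,3,4)] by simp

lemma connection_diff_left:
  assumes "smooth_field X" "smooth_field X'" "smooth_field Y"
  shows "D (X - X') Y = D X Y - D X' Y"
  using connection_add_left[OF assms(1) smooth_uminus[OF assms(2)] assms(3)]
    connection_uminus_left[OF assms(2,3)] by simp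

text \<open>For horizontal \<open>Z\<close> the field \<open>\<theta> Z\<close> vanishes, and with it the vertical part of \<open>D X Z\<close>.\<close>
lemma connection_of_horizontal:
  assumes X: "smooth_field X" and Z: "smooth_field Z" "h Z \<simeq> Z" and u: "at_chart u k"
  shows "D X Z u k = (covariant k u (X u k) Z, nonlinear k u (covariant k u (X u k) Z))"
proof -
  have "fst (\<theta> Z w k) = 0" if "at_chart w k" for w
    using same_at[OF Z(2) at_chartD[OF that]] that
    by (simp add: theta_at Z vertical_proj_at horizontal_proj_at prod_eq_iff)
  then have "covariant k u (X u k) (\<theta> Z) = covariant k u (X u k) 0"
    by (intro covariant_cong) (simp_all add: Z u smooth_theta smooth_zero)
  also have "\<dots> = 0"
    using connection_at[OF X smooth_zero u] connection_zero[OF X] by (simp add: zero_prod_def)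
  finally show ?thesis by (simp add: connection_at X Z u)
qed

lemma connection_horizontal:
  assumes X: "smooth_field X" "h X \<simeq> X" and Z: "smooth_field Z" "h Z \<simeq> Z" and u: "at_chart u k"
  shows "D X Z u k = \<theta> (lie X (J Z)) u k"
proof -
  have "snd (v (lie X (J Z)) u k) = covariant k u (X u k) Z"
    using lie_h_J[OF X(1) Z(1) u] lie_cong[OF X(2) same_refl] same_at[OF X(2) at_chartD[OF u]]
    by simp
  then show ?thesis
    by (simp add: connection_of_horizontal theta_at smooth_lie smooth_J X Z u)
qed

lemma connection_vertical:
  assumes X: "smooth_field X" "h X \<simeq> 0" and Z: "smooth_field Z" "h Z \<simeq> Z" and u: "at_chart u k"
  shows "D X Z u k = h (lie X Z) u k"
proof -
  have vX: "v X w l = X w l" if w: "at_chart w l" for w l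
    using same_at[OF X(2) at_chartD[OF w]] w
    by (simp add: vertical_proj_at horizontal_proj_at X prod_eq_iff linear_0[OF nonlinear_linear])
  then have "v X \<simeq> X" by (simp add: same_def at_chart_def)
  then have "fst (lie X Z u k) = covariant k u (X u k) Z"
    using fst_lie_v[OF X(1) Z(1) u] lie_cong[OF _ same_refl, of "v X" X Z] vX[OF u] by simp
  then show ?thesis
    by (simp add: connection_of_horizontal horizontal_proj_at smooth_lie X Z u)
qed

lemma curvature_eq: "R X Y Z = D X (D Y Z) - D Y (D X Z) - D (lie X Y) Z"
  by (simp add: berwald_curvature_def Let_def)

lemma curvature_off_chart: "\<not> at_chart u k \<Longrightarrow> R X Y Z u k = 0"
  by (simp add: curvature_eq connection_off_chart)

lemma curvature_antisym:
  assumes "smooth_field X" "smooth_field Y" "smooth_field Z" shows "R X Y Z = - R Y X Z"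
proof -
  have "D (lie X Y) Z = - D (lie Y X) Z"
    using connection_uminus_left[OF smooth_lie[OF assms(2,1)] assms(3)] lie_antisym[of X Y] by simp
  then show ?thesis by (simp add: curvature_eq)
qed

lemma curvature_J:
  assumes "smooth_field X" "smooth_field Y" "smooth_field Z" shows "R X Y (J Z) = J (R X Y Z)"
proof -
  have "J (W - W' - W'') = J W - J W' - J W''" for W W' W'' :: "'m svfield"
    by (simp add: J_at fun_eq_iff)
  then show ?thesis
    using assms by (simp add: curvature_eq connection_J smooth_connection smooth_lie)
qed

lemma curvature_cong:
  assumes "Z \<simeq> Z'" "smooth_field X" "smooth_field Y" "smooth_field Z" shows "R X Y Z = R X Y Z'"
proof -
  have "D W Z = D W Z'" if "smooth_field W" for W
    by (rule connection_cong[OF _ that assms(1,4)]) (simp add: same_def)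
  then show ?thesis using assms(2,3) by (simp add: curvature_eq smooth_lie)
qed

end

section \<open>The Berwald frame\<close>

text \<open>The Berwald frame, with \<open>I\<close> for the main scalar and \<open>L\<close> for the Landsberg scalar, since \<open>J\<close> is the
  almost tangent structure.\<close>
locale framed_surface = surface_spray M A S
  for M :: "'m topology" and A :: "('m, real^2) chart set" and S :: "'m svfield" +
  fixes H V :: "'m svfield" and \<rho> I L :: "'m tpoint \<Rightarrow> real"
  assumes field_H: "vector_field (slit_atlas A) H"
    and horizontal_H: "horizontal A S H"
    and V_eq: "eq_on (slit_bundle A) V (J H)"
    and smooth_rho: "smooth_function (slit_atlas A) \<rho>"
    and smooth_I: "smooth_function (slit_atlas A) I"
    and L_eq: "eq_on (slit_bundle A) L (vf_apply (slit_atlas A) S I)"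
    and lie_C_H: "eq_on (slit_bundle A) (lie C H) H"
    and lie_S_H: "eq_on (slit_bundle A) (lie S H) (\<rho> \<odot> V)"
    and lie_V_S: "eq_on (slit_bundle A) (lie V S) H"
    and lie_H_V: "eq_on (slit_bundle A) (lie H V) (S + I \<odot> H + L \<odot> V)"
begin

lemma eq_on_bundle_same: "eq_on (slit_bundle A) X Y \<Longrightarrow> X \<simeq> Y"
  using eq_on_same by (simp add: carrier_slit_atlas)

lemma at_chart_bundle: "at_chart u k \<Longrightarrow> u \<in> slit_bundle A"
  using in_carrier[OF at_chartD] unfolding carrier_slit_atlas .

lemma same_chartI: "(\<And>u k. at_chart u k \<Longrightarrow> X u k = Y u k) \<Longrightarrow> X \<simeq> Y"
  by (simp add: same_def at_chart_def)

lemma same_chartD: "X \<simeq> Y \<Longrightarrow> at_chart u k \<Longrightarrow> X u k = Y u k"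
  by (simp add: same_def at_chart_def)

lemma field_S: "vector_field (slit_atlas A) S"
  using spray by (simp add: spray_def)

lemma JS: "J S \<simeq> C"
  using spray by (intro eq_on_bundle_same) (simp add: spray_def)

lemma JH: "J H \<simeq> V"
  by (rule same_sym[OF eq_on_bundle_same[OF V_eq]])

lemma smooth_H: "smooth_field H"
  using field_H by (simp add: vector_field_def smooth_field_def)

lemma smooth_V: "smooth_field V"
  by (rule smooth_field_cong[OF JH smooth_J[OF smooth_H]])

lemma smooth_C: "smooth_field C"
  by (rule smooth_field_cong[OF JS smooth_J[OF smooth_S]])

lemma bracket_CS: "lie C S \<simeq> S"
  using spray by (intro eq_on_bundle_same) (simp add: spray_def)

lemmas bracket_CH = eq_on_bundle_same[OF lie_C_H]
lemmas bracket_SH = eq_on_bundle_same[OF lie_S_H]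
lemmas bracket_VS = eq_on_bundle_same[OF lie_V_S]
lemmas bracket_HV = eq_on_bundle_same[OF lie_H_V]

lemma bracket_flip: "lie X Y \<simeq> Z \<Longrightarrow> lie Y X \<simeq> - Z"
  by (subst lie_antisym) (rule same_uminus)

lemma hor_H: "h H \<simeq> H"
  using horizontal_H by (intro eq_on_bundle_same) (simp add: horizontal_def)

text \<open>In \<open>2 h S = S + [J S, S] - J [S, S]\<close> the middle term is \<open>[C, S] = S\<close> by homogeneity.\<close>
lemma hor_S: "h S \<simeq> S"
proof (rule same_chartI)
  fix u k assume u: "at_chart u k"
  have "lie (J S) S u k = S u k"
    unfolding lie_cong[OF JS same_refl] by (rule same_chartD[OF bracket_CS u])
  moreover have "lie S S u k = 0" using u by (simp add: lie_at_chart)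
  ultimately show "h S u k = S u k"
    by (simp add: horizontal_proj_def vf_scale_def fn_bracket_form_field_def J_at zero_prod_def[symmetric]
        scaleR_2[symmetric])
qed

lemma snd_horizontal:
  assumes "h X \<simeq> X" "smooth_field X" "at_chart u k"
  shows "snd (X u k) = nonlinear k u (fst (X u k))"
  using same_chartD[OF assms(1,3)] horizontal_proj_at[OF assms(2,3)] by (metis snd_conv)

lemmas snd_H = snd_horizontal[OF hor_H smooth_H]
lemmas snd_S = snd_horizontal[OF hor_S smooth_S]

lemma at_V: "at_chart u k \<Longrightarrow> V u k = (0, fst (H u k))"
  using same_chartD[OF JH] by (simp add: J_at)

lemma at_C: "at_chart u k \<Longrightarrow> C u k = (0, fst (S u k))"
  using same_chartD[OF JS] by (simp add: J_at)

lemma vert_V: "h V \<simeq> 0"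
  by (rule same_chartI) (simp add: horizontal_proj_at smooth_V at_V linear_0[OF nonlinear_linear] zero_prod_def)

lemma vert_C: "h C \<simeq> 0"
  by (rule same_chartI) (simp add: horizontal_proj_at smooth_C at_C linear_0[OF nonlinear_linear] zero_prod_def)

lemma tangent_S: "at_chart u k \<Longrightarrow> S u \<in> tangent_space (slit_atlas A) u"
  using field_S at_chart_bundle unfolding vector_field_def carrier_slit_atlas by blast

lemma tangent_H: "at_chart u k \<Longrightarrow> H u \<in> tangent_space (slit_atlas A) u"
  using field_H at_chart_bundle unfolding vector_field_def carrier_slit_atlas by blast

lemma tangent_V: "at_chart u k \<Longrightarrow> V u \<in> tangent_space (slit_atlas A) u"
  using almost_tangent_tangent[of H u] tangent_H V_eq at_chart_bundle by (simp add: eq_on_def)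

lemma L_chart: "at_chart u k \<Longrightarrow> L u = chart_deriv k S I u"
  using L_eq vf_apply_chart[of S u, OF tangent_S smooth_I at_chartD] at_chart_bundle by (simp add: eq_on_def)

lemma smooth_L: "smooth_function (slit_atlas A) L"
  by (rule smooth_chart_deriv[OF smooth_S smooth_I]) (simp add: L_chart at_chart_def)

lemmas smooth_frame = smooth_H smooth_V smooth_S smooth_C smooth_rho smooth_I smooth_L
  smooth_add smooth_diff smooth_scale smooth_uminus smooth_zero smooth_lie smooth_J

lemma at_scale: "(f \<odot> X) u k = f u *\<^sub>R X u k"
  by (simp add: vf_scale_def)

text \<open>By \<open>[C, H] = H\<close> the derivative of the \<open>x\<close>-components of \<open>H\<close> along \<open>C\<close> reproduces them, and they are the
  vertical components of \<open>V\<close>. The derivative of \<open>C\<close> itself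
  is that of \<open>J S\<close>, which \<open>field_deriv_J\<close> computes.\<close>
lemma bracket_CV: "lie C V \<simeq> 0"
proof (rule same_chartI)
  fix u k assume u: "at_chart u k"
  have dC: "field_deriv k u (J S) w = (0, snd w)" for w
    by (simp add: field_deriv_J smooth_S u fst_field_deriv_S)
  have "lie (J S) H u k = H u k"
    unfolding lie_cong[OF JS same_refl] by (rule same_chartD[OF bracket_CH u])
  then have "fst (field_deriv k u H (J S u k)) = fst (H u k)"
    by (auto simp: lie_at_chart u dC prod_eq_iff)
  then have "lie (J S) (J H) u k = 0"
    using dC[of "(0, fst (H u k))"]
    by (simp add: lie_at_chart u field_deriv_J[OF smooth_H u] J_at[of H] dC zero_prod_def)
  then show "lie C V u k = 0 u k" unfolding lie_cong[OF JS JH] by simp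
qed

lemma fst_S_nonzero: "at_chart u k \<Longrightarrow> fst (S u k) \<noteq> 0"
  by (cases u) (auto simp: fst_S at_chart_def slit_atlas_def slit_chart_domain slit_chart_map)

text \<open>At a point where the \<open>x\<close>-components of \<open>H\<close> vanish, so do the horizontal field \<open>H\<close> and \<open>V = J H\<close>; then
  their bracket is zero there as well, and \<open>[H, V] = S + I H + L V\<close> makes \<open>S\<close> vanish.\<close>
lemma fst_H_nonzero:
  assumes u: "at_chart u k" shows "fst (H u k) \<noteq> 0"
proof
  assume a: "fst (H u k) = 0"
  then have "H u k = 0" "V u k = 0"
    using snd_H[OF u] at_V[OF u] by (simp_all add: linear_0[OF nonlinear_linear[OF u]] prod_eq_iff)
  then have "lie H V u k = 0"
    by (simp add: lie_at_chart u linear_0[OF field_deriv_linear[OF _ u]] smooth_H smooth_V)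
  moreover have "lie H V u k = S u k + I u *\<^sub>R H u k + L u *\<^sub>R V u k"
    using same_chartD[OF bracket_HV u] by (simp add: at_scale)
  ultimately have "S u k = 0" using \<open>H u k = 0\<close> \<open>V u k = 0\<close> by simp
  then show False using fst_S_nonzero[OF u] by simp
qed

text \<open>By the Jacobi identity, \<open>[C, H] = H\<close> and \<open>[C, V] = 0\<close>, bracketing with \<open>C\<close> fixes
  \<open>[H, V] = S + I H + L V\<close>. Comparing \<open>x\<close>-components gives the first equation, and then the coefficients of \<open>V\<close> the second.\<close>
lemma homogeneity:
  assumes u: "at_chart u k" shows "chart_deriv k C I u = 0" "chart_deriv k C L u = L u"
proof -
  have "lie C (lie H V) = lie C (S + I \<odot> H + L \<odot> V)"
    by (rule lie_cong[OF same_refl bracket_HV])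
  then have "lie C (lie H V) u k = S u k + (chart_deriv k C I u *\<^sub>R H u k + I u *\<^sub>R H u k)
      + chart_deriv k C L u *\<^sub>R V u k"
    using u same_chartD[OF bracket_CS u] same_chartD[OF bracket_CH u] same_chartD[OF bracket_CV u]
    by (simp add: lie_add_right lie_scale_right smooth_frame at_chartD)
  moreover have "lie C (lie H V) = lie H V + lie H 0"
    unfolding lie_jacobi[OF smooth_C smooth_H smooth_V] lie_cong[OF bracket_CH same_refl]
      lie_cong[OF same_refl bracket_CV] ..
  moreover have "lie H 0 u k = 0"
    using lie_add_right[OF smooth_H smooth_zero smooth_zero at_chartD[OF u]] by simp
  moreover have "lie H V u k = S u k + I u *\<^sub>R H u k + L u *\<^sub>R V u k"
    using same_chartD[OF bracket_HV u] by (simp add: at_scale)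
  ultimately have eq: "chart_deriv k C I u *\<^sub>R H u k + chart_deriv k C L u *\<^sub>R V u k = L u *\<^sub>R V u k"
    by simp
  then have "chart_deriv k C I u *\<^sub>R fst (H u k) = 0"
    using at_V[OF u] by (auto simp: prod_eq_iff)
  then show I: "chart_deriv k C I u = 0" using fst_H_nonzero[OF u] by simp
  then have "chart_deriv k C L u *\<^sub>R fst (H u k) = L u *\<^sub>R fst (H u k)"
    using eq at_V[OF u] by (auto simp: prod_eq_iff)
  then show "chart_deriv k C L u = L u" using fst_H_nonzero[OF u] by simp
qed

text \<open>This applies to \<open>[H, C] = - H\<close>, \<open>[S, V] = - H\<close> and \<open>[S, C] = - S\<close>, so three of the four derivatives of
  horizontal frame fields along horizontal frame fields vanish.\<close>
lemma theta_horizontal_zero: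
  assumes "W \<simeq> - X" "h X \<simeq> X" "smooth_field X" "at_chart u k"
  shows "\<theta> W u k = 0"
proof -
  have W: "smooth_field W"
    by (rule smooth_field_cong[OF same_sym[OF assms(1)] smooth_uminus[OF assms(3)]])
  have "W u k = - X u k" using same_chartD[OF assms(1,4)] by simp
  then show ?thesis
    using snd_horizontal[OF assms(2-4)] assms(4)
    by (simp add: theta_at W vertical_proj_at linear_neg[OF nonlinear_linear]
        linear_0[OF nonlinear_linear] zero_prod_def)
qed

lemma connection_HH: "D H H \<simeq> L \<odot> H"
proof (rule same_chartI)
  fix u k assume u: "at_chart u k"
  note lin = linear_add[OF nonlinear_linear[OF u]] linear_cmul[OF nonlinear_linear[OF u]]
  have "lie H V u k = S u k + I u *\<^sub>R H u k + L u *\<^sub>R V u k"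
    using same_chartD[OF bracket_HV u] by (simp add: at_scale)
  then have "snd (v (lie H V) u k) = L u *\<^sub>R fst (H u k)"
    by (simp add: vertical_proj_at smooth_frame u snd_H snd_S at_V lin)
  then have "\<theta> (lie H V) u k = L u *\<^sub>R H u k"
    by (simp add: theta_at smooth_frame u lin prod_eq_iff snd_H)
  then show "D H H u k = (L \<odot> H) u k"
    using connection_horizontal[OF smooth_H hor_H smooth_H hor_H u] lie_cong[OF same_refl JH, of H]
    by (simp add: at_scale)
qed

lemma connection_HS: "D H S \<simeq> 0"
  using theta_horizontal_zero[OF bracket_flip[OF bracket_CH] hor_H smooth_H]
    connection_horizontal[OF smooth_H hor_H smooth_S hor_S] lie_cong[OF same_refl JS, of H]
  by (intro same_chartI) simp

lemma connection_SH: "D S H \<simeq> 0"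
  using theta_horizontal_zero[OF bracket_flip[OF bracket_VS] hor_H smooth_H]
    connection_horizontal[OF smooth_S hor_S smooth_H hor_H] lie_cong[OF same_refl JH, of S]
  by (intro same_chartI) simp

lemma connection_SS: "D S S \<simeq> 0"
  using theta_horizontal_zero[OF bracket_flip[OF bracket_CS] hor_S smooth_S]
    connection_horizontal[OF smooth_S hor_S smooth_S hor_S] lie_cong[OF same_refl JS, of S]
  by (intro same_chartI) simp

lemma connection_VH: "D V H \<simeq> - (S + I \<odot> H)"
proof (rule same_chartI)
  fix u k assume u: "at_chart u k"
  have "fst (lie V H u k) = - (fst (S u k) + I u *\<^sub>R fst (H u k))"
    using same_chartD[OF bracket_flip[OF bracket_HV] u] at_V[OF u] by (simp add: at_scale)
  then show "D V H u k = (- (S + I \<odot> H)) u k"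
    using connection_vertical[OF smooth_V vert_V smooth_H hor_H u]
    by (simp add: horizontal_proj_at smooth_frame u at_scale prod_eq_iff snd_H snd_S
        linear_neg[OF nonlinear_linear] linear_diff[OF nonlinear_linear] linear_add[OF nonlinear_linear]
        linear_cmul[OF nonlinear_linear])
qed

lemma h_same: "W \<simeq> X \<Longrightarrow> h X \<simeq> X \<Longrightarrow> smooth_field X \<Longrightarrow> h W \<simeq> X"
  using h_cong[OF same_sym, of W X] by (meson same_sym same_trans)

lemma connection_VS: "D V S \<simeq> H"
  using connection_vertical[OF smooth_V vert_V smooth_S hor_S] same_chartD[OF h_same[OF bracket_VS hor_H smooth_H]]
  by (intro same_chartI) simp

lemma connection_CH: "D C H \<simeq> H"
  using connection_vertical[OF smooth_C vert_C smooth_H hor_H] same_chartD[OF h_same[OF bracket_CH hor_H smooth_H]]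
  by (intro same_chartI) simp

lemma connection_CS: "D C S \<simeq> S"
  using connection_vertical[OF smooth_C vert_C smooth_S hor_S] same_chartD[OF h_same[OF bracket_CS hor_S smooth_S]]
  by (intro same_chartI) simp

lemma connection_cong_right: "Y \<simeq> Y' \<Longrightarrow> smooth_field X \<Longrightarrow> smooth_field Y' \<Longrightarrow> D X Y = D X Y'"
  by (metis connection_cong same_refl same_sym smooth_field_cong)

lemma connection_cong_left: "X \<simeq> X' \<Longrightarrow> smooth_field X' \<Longrightarrow> smooth_field Y \<Longrightarrow> D X Y = D X' Y"
  by (metis connection_cong same_refl same_sym smooth_field_cong)

text \<open>Derivatives and brackets of the frame may be replaced by their expressions in the frame before
  differentiating again.\<close>
lemma curvature_frame_at:
  assumes "D Y Z \<simeq> P" "D X Z \<simeq> Q" "lie X Y \<simeq> W"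
    and "smooth_field X" "smooth_field Y" "smooth_field Z" "smooth_field P" "smooth_field Q" "smooth_field W"
  shows "R X Y Z u k = D X P u k - D Y Q u k - D W Z u k"
  using assms by (simp add: curvature_eq connection_cong_right[of _ P] connection_cong_right[of _ Q]
      connection_cong_left[of _ W])

lemma connection_values:
  assumes u: "at_chart u k"
  shows "D H H u k = L u *\<^sub>R H u k" "D H S u k = 0" "D S H u k = 0" "D S S u k = 0"
    "D V H u k = - (S u k + I u *\<^sub>R H u k)" "D V S u k = H u k" "D C H u k = H u k" "D C S u k = S u k"
  using u connection_HH connection_HS connection_SH connection_SS connection_VH connection_VS
    connection_CH connection_CS by (auto dest: same_chartD simp: at_scale)

lemmas curvature_expand = connection_values connection_zero connection_uminus_right connection_uminus_left
  connection_add_left connection_add_right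
  connection_diff_left connection_diff_right connection_scale_left connection_scale_right at_scale smooth_frame

lemma curvature_SHS: "at_chart u k \<Longrightarrow> R S H S u k = - (\<rho> u *\<^sub>R H u k)"
  by (subst curvature_frame_at[OF connection_HS connection_SS bracket_SH])
    (simp_all add: curvature_expand)

lemma curvature_SHH:
  "at_chart u k \<Longrightarrow> R S H H u k = (chart_deriv k S L u + \<rho> u * I u) *\<^sub>R H u k + \<rho> u *\<^sub>R S u k"
  by (subst curvature_frame_at[OF connection_HH connection_SH bracket_SH])
    (simp_all add: curvature_expand algebra_simps)

lemma curvature_VHH:
  assumes u: "at_chart u k"
  shows "R V H H u k = (chart_deriv k H I u + chart_deriv k V L u) *\<^sub>R H u k - (2 * L u) *\<^sub>R S u k"
proof -
  have double: "(2 * L u) *\<^sub>R S u k = L u *\<^sub>R S u k + L u *\<^sub>R S u k"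
    by (simp only: mult_2 scaleR_left_distrib)
  show ?thesis
    unfolding double
    by (subst curvature_frame_at[OF connection_HH connection_VH bracket_flip[OF bracket_HV]])
      (simp_all add: curvature_expand algebra_simps u)
qed

lemma curvature_VHS: "at_chart u k \<Longrightarrow> R V H S u k = 0"
  by (subst curvature_frame_at[OF connection_HS connection_VS bracket_flip[OF bracket_HV]])
    (simp_all add: curvature_expand)

text \<open>On \<open>H\<close> the terms add up to \<open>(S(I) - L) H\<close>.\<close>
lemma curvature_VS:
  assumes "at_chart u k" shows "R V S H u k = 0" "R V S S u k = 0"
proof -
  show "R V S H u k = 0"
    by (subst curvature_frame_at[OF connection_SH connection_VH bracket_VS]) (simp_all add: curvature_expand assms L_chart[symmetric] homogeneity)
  show "R V S S u k = 0"
    by (subst curvature_frame_at[OF connection_SS connection_VS bracket_VS]) (simp_all add: curvature_expand assms L_chart[symmetric] homogeneity)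
qed

text \<open>On \<open>H\<close> the terms add up to \<open>(C(L) - L) H\<close>.\<close>
lemma curvature_CH:
  assumes "at_chart u k" shows "R C H H u k = 0" "R C H S u k = 0"
proof -
  show "R C H H u k = 0"
    by (subst curvature_frame_at[OF connection_HH connection_CH bracket_CH]) (simp_all add: curvature_expand assms L_chart[symmetric] homogeneity)
  show "R C H S u k = 0"
    by (subst curvature_frame_at[OF connection_HS connection_CS bracket_CH]) (simp_all add: curvature_expand assms L_chart[symmetric] homogeneity)
qed

lemma curvature_CS:
  assumes "at_chart u k" shows "R C S H u k = 0" "R C S S u k = 0"
proof -
  show "R C S H u k = 0"
    by (subst curvature_frame_at[OF connection_SH connection_CH bracket_CS]) (simp_all add: curvature_expand assms L_chart[symmetric] homogeneity)
  show "R C S S u k = 0"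
    by (subst curvature_frame_at[OF connection_SS connection_CS bracket_CS]) (simp_all add: curvature_expand assms L_chart[symmetric] homogeneity)
qed

text \<open>On \<open>H\<close> the terms add up to \<open>C(I) H\<close>.\<close>
lemma curvature_VC:
  assumes "at_chart u k" shows "R V C H u k = 0" "R V C S u k = 0"
proof -
  show "R V C H u k = 0"
    by (subst curvature_frame_at[OF connection_CH connection_VH bracket_flip[OF bracket_CV]]) (simp_all add: curvature_expand assms L_chart[symmetric] homogeneity)
  show "R V C S u k = 0"
    by (subst curvature_frame_at[OF connection_CS connection_VS bracket_flip[OF bracket_CV]]) (simp_all add: curvature_expand assms L_chart[symmetric] homogeneity)
qed

lemma curvature_on_vertical:
  assumes "smooth_field X" "smooth_field Y"
  shows "R X Y V = J (R X Y H)" "R X Y C = J (R X Y S)"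
  using curvature_cong[OF JH assms smooth_J[OF smooth_H]] curvature_cong[OF JS assms smooth_J[OF smooth_S]]
    curvature_J[OF assms] smooth_H smooth_S by simp_all

lemma frame_off_chart:
  assumes "u \<in> slit_bundle A" "\<not> at_chart u k"
  shows "H u k = 0" "S u k = 0" "V u k = 0" "C u k = 0"
proof -
  have z: "X u k = 0" if "vector_field (slit_atlas A) X" for X
    using that assms unfolding vector_field_def carrier_slit_atlas tangent_space_def at_chart_def by blast
  show "H u k = 0" "S u k = 0" by (rule z[OF field_H], rule z[OF field_S])
  then show "V u k = 0" using V_eq assms(1) by (simp add: eq_on_def J_at zero_prod_def)
  show "C u k = 0" using assms(2) unfolding liouville_def at_chart_def by (simp only: if_False)
qed

lemma eq_on_bundleI:
  assumes "\<And>u k. at_chart u k \<Longrightarrow> X u k = Y u k"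
    and "\<And>u k. u \<in> slit_bundle A \<Longrightarrow> \<not> at_chart u k \<Longrightarrow> X u k = Y u k"
  shows "eq_on (slit_bundle A) X Y"
  unfolding eq_on_def using assms by blast

end

theorem proposition3p5:
  fixes M :: "'m topology" and A :: "('m, real^2) chart set"
    and F K \<rho> \<I> \<J> \<F> :: "'m tpoint \<Rightarrow> real"
    and S H V C :: "'m svfield"
    and R :: "'m svfield \<Rightarrow> 'm svfield \<Rightarrow> 'm svfield \<Rightarrow> 'm svfield"
  defines "C \<equiv> liouville A"
    and "\<rho> \<equiv> K * F * F"
    and "\<F> \<equiv> vf_apply (slit_atlas A) H \<I> + vf_apply (slit_atlas A) V \<J>"
    and "R \<equiv> berwald_curvature A S"
  assumes manifold: "smooth_manifold M A"
    and finsler: "finsler_function A F"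
    and geodesic: "geodesic_spray A F S"
    and flag: "flag_curvature A F S K"
    and nonflat: "\<forall>u\<in>slit_bundle A. K u \<noteq> 0"
    and frame: "berwald_frame A F S \<rho> H V \<I> \<J>"
  shows
     "(eq_on (slit_bundle A) (R S H S) (- (\<rho> \<odot> H)) \<and>
       eq_on (slit_bundle A) (R S H H)
         ((vf_apply (slit_atlas A) S \<J> + \<rho> * \<I>) \<odot> H + \<rho> \<odot> S)) \<and>
      eq_on (slit_bundle A) (R V H H) (\<F> \<odot> H - (\<lambda>u. 2 * \<J> u) \<odot> S) \<and>
      (eq_on (slit_bundle A) (R S H C) (- (\<rho> \<odot> V)) \<and>
       eq_on (slit_bundle A) (R S H V)
         ((vf_apply (slit_atlas A) S \<J> + \<rho> * \<I>) \<odot> V + \<rho> \<odot> C) \<and>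
       eq_on (slit_bundle A) (R V H V) (\<F> \<odot> V - (\<lambda>u. 2 * \<J> u) \<odot> C)) \<and>
      (\<forall>X\<in>{H, S, V, C}. \<forall>Y\<in>{H, S, V, C}. \<forall>Z\<in>{H, S, V, C}.
         eq_on (slit_bundle A) (R X Y Z) (- R Y X Z) \<and>
         eq_on (slit_bundle A) (R X Y (almost_tangent Z)) (almost_tangent (R X Y Z))) \<and>
      (eq_on (slit_bundle A) (R V H S) 0 \<and> eq_on (slit_bundle A) (R V H C) 0 \<and>
       (\<forall>Z\<in>{H, S, V, C}.
          eq_on (slit_bundle A) (R V S Z) 0 \<and> eq_on (slit_bundle A) (R C H Z) 0 \<and>
          eq_on (slit_bundle A) (R C S Z) 0 \<and> eq_on (slit_bundle A) (R V C Z) 0))"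
proof -
  interpret surface M A by unfold_locales (rule manifold)
  interpret framed_surface M A S H V \<rho> \<I> \<J>
  proof unfold_locales
    show "spray A S" using geodesic by (simp add: geodesic_spray_def)
    show "smooth_function (slit_atlas A) \<rho>"
      using finsler flag unfolding \<rho>_def finsler_function_def flag_curvature_def
      by (intro smooth_function_mult) auto
  qed (use frame in \<open>simp_all add: berwald_frame_def Let_def\<close>)
  have deriv: "chart_deriv k S \<J> u = vf_apply (slit_atlas A) S \<J> u"
    "chart_deriv k H \<I> u + chart_deriv k V \<J> u = \<F> u" if "at_chart u k" for u k
    using vf_apply_chart[where X = S and p = u, OF tangent_S[OF that] smooth_L at_chartD[OF that]]
      vf_apply_chart[where X = H and p = u, OF tangent_H[OF that] smooth_I at_chartD[OF that]]
      vf_apply_chart[where X = V and p = u, OF tangent_V[OF that] smooth_L at_chartD[OF that]]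
    by (simp_all add: \<F>_def)
  note components = curvature_SHS curvature_SHH curvature_VHH curvature_VHS curvature_VS curvature_CH
    curvature_CS curvature_VC deriv
  have R: "R = berwald_curvature A S" and C: "C = liouville A" by (simp_all add: R_def C_def)
  note vertical = curvature_on_vertical[OF smooth_S smooth_H] curvature_on_vertical[OF smooth_V smooth_H]
    curvature_on_vertical[OF smooth_V smooth_S] curvature_on_vertical[OF smooth_C smooth_H]
    curvature_on_vertical[OF smooth_C smooth_S] curvature_on_vertical[OF smooth_V smooth_C]
  have SH: "eq_on (slit_bundle A) (R S H S) (- (\<rho> \<odot> H))"
    "eq_on (slit_bundle A) (R S H H) ((vf_apply (slit_atlas A) S \<J> + \<rho> * \<I>) \<odot> H + \<rho> \<odot> S)"
    "eq_on (slit_bundle A) (R S H C) (- (\<rho> \<odot> V))"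
    "eq_on (slit_bundle A) (R S H V) ((vf_apply (slit_atlas A) S \<J> + \<rho> * \<I>) \<odot> V + \<rho> \<odot> C)"
    unfolding R C vertical
    by (rule eq_on_bundleI; simp add: components curvature_off_chart frame_off_chart at_scale J_at at_V at_C
        zero_prod_def[symmetric])+
  have VH: "eq_on (slit_bundle A) (R V H H) (\<F> \<odot> H - (\<lambda>u. 2 * \<J> u) \<odot> S)"
    "eq_on (slit_bundle A) (R V H V) (\<F> \<odot> V - (\<lambda>u. 2 * \<J> u) \<odot> C)"
    unfolding R C vertical
    by (rule eq_on_bundleI; simp add: components curvature_off_chart frame_off_chart at_scale J_at at_V at_C
        zero_prod_def[symmetric])+
  have zero: "eq_on (slit_bundle A) (R X Y Z) 0" if "\<And>u k. at_chart u k \<Longrightarrow> R X Y Z u k = 0" for X Y Z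
    unfolding R by (rule eq_on_bundleI) (simp_all add: that[unfolded R] curvature_off_chart)
  have VHS: "eq_on (slit_bundle A) (R V H S) 0" "eq_on (slit_bundle A) (R V H C) 0"
    by (rule zero; simp add: R C vertical components J_at zero_prod_def)+
  have vanishing: "eq_on (slit_bundle A) (R V S Z) 0 \<and> eq_on (slit_bundle A) (R C H Z) 0 \<and>
      eq_on (slit_bundle A) (R C S Z) 0 \<and> eq_on (slit_bundle A) (R V C Z) 0" if "Z \<in> {H, S, V, C}" for Z
    using that
    by (intro conjI zero) (auto simp: R C vertical components J_at zero_prod_def)
  have smooth: "smooth_field Z" if "Z \<in> {H, S, V, C}" for Z
    using that smooth_H smooth_S smooth_V smooth_C unfolding C by auto
  have general: "eq_on (slit_bundle A) (R X Y Z) (- R Y X Z) \<and>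
      eq_on (slit_bundle A) (R X Y (almost_tangent Z)) (almost_tangent (R X Y Z))"
    if "X \<in> {H, S, V, C}" "Y \<in> {H, S, V, C}" "Z \<in> {H, S, V, C}" for X Y Z
    unfolding R eq_on_def
    using curvature_antisym[OF smooth[OF that(1)] smooth[OF that(2)] smooth[OF that(3)]]
      curvature_J[OF smooth[OF that(1)] smooth[OF that(2)] smooth[OF that(3)]] by metis
  show ?thesis
    by (intro conjI ballI SH VH VHS) (use vanishing general in blast)+
qed

end
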